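(* Let $G$ be a finite multigraph and let $H \subseteq G$ be an open or closed Eulerian subgraph. Then any consistent orientation $\vec H$ of $H$ can be extended to a well-balanced orientation of $G$.
   Context: A subgraph $H$ is closed (resp. open) Eulerian if it has a closed (resp. open) trail using every edge of $H$ exactly once; a consistent orientation of $H$ is an orientation of its edges along such a trail. For vertices $x,y$, $\lambda(x,y)$ is the maximum number of pairwise edge-disjoint $x$–$y$ paths in $G$ and $\lambda^*(x,y)$ is the greatest even number not exceeding $\lambda(x,y)$. In an orientation $\vec G$, $\alpha(x,y)$ is the maximum number of pairwise arc-disjoint directed paths from $x$ to $y$. An orientation $\vec G$ of $G$ is well-balanced if $\alpha(x,y) \geq \lambda^*(x,y)/2$ for any two distinct vertices $x,y$ of $G$. *)

theory Defs
  imports Complex_Main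
begin

text \<open>A finite multigraph is given by a vertex set V, an edge set E and an endpoint
map ends :: 'e => 'v * 'v (the pair fixes an arbitrary reference direction; parallel
edges and loops are allowed). An orientation is a map 'e => bool: True keeps the
reference direction, False reverses it.\<close>

definition multigraph :: "'v set \<Rightarrow> 'e set \<Rightarrow> ('e \<Rightarrow> 'v \<times> 'v) \<Rightarrow> bool" where
  "multigraph V E ends \<longleftrightarrow> finite V \<and> finite E \<and>
     (\<forall>e\<in>E. fst (ends e) \<in> V \<and> snd (ends e) \<in> V)"

definition arc :: "('e \<Rightarrow> 'v \<times> 'v) \<Rightarrow> ('e \<Rightarrow> bool) \<Rightarrow> 'e \<Rightarrow> 'v \<times> 'v" where
  "arc ends ori e = (if ori e then ends e else (snd (ends e), fst (ends e)))"

definition is_walk :: "'e set \<Rightarrow> ('e \<Rightarrow> 'v \<times> 'v) \<Rightarrow> 'v \<Rightarrow> 'v \<Rightarrow> 'e list \<Rightarrow> 'v list \<Rightarrow> bool" where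
  "is_walk E ends x y es vs \<longleftrightarrow> length vs = Suc (length es) \<and> hd vs = x \<and> last vs = y \<and>
     set es \<subseteq> E \<and>
     (\<forall>i<length es. ends (es ! i) = (vs ! i, vs ! Suc i) \<or> ends (es ! i) = (vs ! Suc i, vs ! i))"

definition is_trail :: "'e set \<Rightarrow> ('e \<Rightarrow> 'v \<times> 'v) \<Rightarrow> 'v \<Rightarrow> 'v \<Rightarrow> 'e list \<Rightarrow> 'v list \<Rightarrow> bool" where
  "is_trail E ends x y es vs \<longleftrightarrow> is_walk E ends x y es vs \<and> distinct es"

definition is_path :: "'e set \<Rightarrow> ('e \<Rightarrow> 'v \<times> 'v) \<Rightarrow> 'v \<Rightarrow> 'v \<Rightarrow> 'e list \<Rightarrow> 'v list \<Rightarrow> bool" where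
  "is_path E ends x y es vs \<longleftrightarrow> is_walk E ends x y es vs \<and> distinct vs"

definition is_dipath :: "'e set \<Rightarrow> ('e \<Rightarrow> 'v \<times> 'v) \<Rightarrow> ('e \<Rightarrow> bool) \<Rightarrow> 'v \<Rightarrow> 'v \<Rightarrow> 'e list \<Rightarrow> 'v list \<Rightarrow> bool" where
  "is_dipath E ends ori x y es vs \<longleftrightarrow> length vs = Suc (length es) \<and> hd vs = x \<and> last vs = y \<and>
     set es \<subseteq> E \<and> distinct vs \<and>
     (\<forall>i<length es. arc ends ori (es ! i) = (vs ! i, vs ! Suc i))"

definition k_edge_disjoint :: "('e list \<Rightarrow> 'v list \<Rightarrow> bool) \<Rightarrow> nat \<Rightarrow> bool" where
  "k_edge_disjoint P k \<longleftrightarrow> (\<exists>ps :: ('e list \<times> 'v list) list. length ps = k \<and>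
     (\<forall>p\<in>set ps. P (fst p) (snd p)) \<and>
     (\<forall>i<k. \<forall>j<k. i \<noteq> j \<longrightarrow> set (fst (ps ! i)) \<inter> set (fst (ps ! j)) = {}))"

definition lambda :: "'e set \<Rightarrow> ('e \<Rightarrow> 'v \<times> 'v) \<Rightarrow> 'v \<Rightarrow> 'v \<Rightarrow> nat" where
  "lambda E ends x y = Max {k. k_edge_disjoint (is_path E ends x y) k}"

definition lambda_star :: "'e set \<Rightarrow> ('e \<Rightarrow> 'v \<times> 'v) \<Rightarrow> 'v \<Rightarrow> 'v \<Rightarrow> nat" where
  "lambda_star E ends x y = 2 * (lambda E ends x y div 2)"

definition alpha :: "'e set \<Rightarrow> ('e \<Rightarrow> 'v \<times> 'v) \<Rightarrow> ('e \<Rightarrow> bool) \<Rightarrow> 'v \<Rightarrow> 'v \<Rightarrow> nat" where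
  "alpha E ends ori x y = Max {k. k_edge_disjoint (is_dipath E ends ori x y) k}"

definition well_balanced :: "'v set \<Rightarrow> 'e set \<Rightarrow> ('e \<Rightarrow> 'v \<times> 'v) \<Rightarrow> ('e \<Rightarrow> bool) \<Rightarrow> bool" where
  "well_balanced V E ends ori \<longleftrightarrow>
     (\<forall>x\<in>V. \<forall>y\<in>V. x \<noteq> y \<longrightarrow> real (alpha E ends ori x y) \<ge> real (lambda_star E ends x y) / 2)"

text \<open>H (edge set F) is open ori closed Eulerian: some trail uses every edge of F exactly once.
A consistent orientation of H orients every edge of F along such a trail.\<close>
definition eulerian_trail :: "'e set \<Rightarrow> ('e \<Rightarrow> 'v \<times> 'v) \<Rightarrow> 'e set \<Rightarrow> 'e list \<Rightarrow> 'v list \<Rightarrow> bool" where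
  "eulerian_trail E ends F es vs \<longleftrightarrow> is_trail E ends (hd vs) (last vs) es vs \<and> set es = F"

definition consistent_orientation :: "'e set \<Rightarrow> ('e \<Rightarrow> 'v \<times> 'v) \<Rightarrow> 'e set \<Rightarrow> ('e \<Rightarrow> bool) \<Rightarrow> bool" where
  "consistent_orientation E ends F ori \<longleftrightarrow> (\<exists>es vs. eulerian_trail E ends F es vs \<and>
     (\<forall>i<length es. arc ends ori (es ! i) = (vs ! i, vs ! Suc i)))"

end

theory Submission
  imports Defs
begin

text \<open>
Nash-Williams' odd-vertex-pairing argument. Let \<open>d X\<close> be the number of edges leaving \<open>X\<close> and \<open>R X\<close> the
largest \<open>\<lambda>*(x, y)\<close> over pairs separated by \<open>X\<close>. Suppose the odd-degree vertices can be paired up so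
that every \<open>X\<close> splits at most \<open>d X - R X\<close> pairs. Add the pairs as edges, replace the trail \<open>H\<close>
by a single edge joining its ends, and orient the resulting even graph with in-degree equal to
out-degree everywhere, the new edge along the trail. Then at least \<open>R X / 2\<close> arcs of \<open>G\<close> leave
\<open>X\<close>, and Menger's theorem for arcs gives the claim.

The pairing is found by induction on \<open>|V| + |E|\<close>, where \<open>R\<close> is skew-supermodular. If
\<open>d X = R X\<close> for some \<open>X\<close> with at least two vertices on both sides, contract either side and
combine the two pairings. Otherwise deleting an edge lowers \<open>R\<close> only at vertices \<open>s\<close> with
\<open>d {s} = R {s}\<close>, so we may assume that all neighbours of odd vertices are of this kind. Let \<open>s\<close> be
one of minimum degree. If some \<open>X\<close> separates two such neighbours with \<open>d X = R X + 1 < d {s}\<close>, one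
with \<open>d X\<close> minimum can again be contracted on either side. If there is none, delete an edge from
\<open>s\<close> to an odd vertex \<open>u\<close> and let \<open>u\<close> take over the partner that \<open>s\<close> has in the smaller graph.
\<close>

section \<open>Cuts and local connectivity\<close>

text \<open>Integer indicators allow submodularity and parity to be checked edge by edge. Loops
  count 0, so \<open>cutdeg E ends {v}\<close> is the degree of \<open>v\<close> without
  loops.\<close>

definition cutdeg :: "'e set \<Rightarrow> ('e \<Rightarrow> 'v \<times> 'v) \<Rightarrow> 'v set \<Rightarrow> int" where
  "cutdeg E ends X = (\<Sum>e\<in>E. of_bool ((fst (ends e) \<in> X) \<noteq> (snd (ends e) \<in> X)))"

definition split :: "('v \<Rightarrow> 'v) \<Rightarrow> 'v set \<Rightarrow> int" where
  "split m X = int (card {v\<in>X. m v \<notin> X})"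

locale mgraph =
  fixes V :: "'v set" and E :: "'e set" and ends :: "'e \<Rightarrow> 'v \<times> 'v"
  assumes multigraph: "multigraph V E ends"
begin

abbreviation d :: "'v set \<Rightarrow> int" where
  "d \<equiv> cutdeg E ends"

text \<open>Local edge-connectivity in min-cut form, the form that uncrossing works with;
  \<open>lambda_le_cut\<close> links it to path counts.\<close>

definition lam :: "'v \<Rightarrow> 'v \<Rightarrow> int" where
  "lam x y = Min (d ` {X. X \<subseteq> V \<and> x \<in> X \<and> y \<notin> X})"

definition lams :: "'v \<Rightarrow> 'v \<Rightarrow> int" where
  "lams x y = 2 * (lam x y div 2)"

text \<open>The inserted 0 is the value at sets that separate no two vertices of
  \<open>V\<close>.\<close>

definition R :: "'v set \<Rightarrow> int" where
  "R X = Max (insert 0 ((\<lambda>(x, y). lams x y) ` ((X \<inter> V) \<times> (V - X))))"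

text \<open>Even vertices are kept as fixed points, so that \<open>split m X\<close> counts the pairs separated by \<open>X\<close>.\<close>

definition pairing :: "('v \<Rightarrow> 'v) \<Rightarrow> bool" where
  "pairing m \<longleftrightarrow> (\<forall>v\<in>V. m v \<in> V \<and> m (m v) = v \<and> (m v = v \<longleftrightarrow> even (d {v})))"

definition feasible :: "('v \<Rightarrow> 'v) \<Rightarrow> bool" where
  "feasible m \<longleftrightarrow> pairing m \<and> (\<forall>X\<subseteq>V. split m X + R X \<le> d X)"

definition odds :: "'v set" where
  "odds = {v\<in>V. odd (d {v})}"

lemma finV: "finite V" and finE: "finite E"
  and ends_in: "e \<in> E \<Longrightarrow> fst (ends e) \<in> V" "e \<in> E \<Longrightarrow> snd (ends e) \<in> V"
  using multigraph by (auto simp: multigraph_def)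

lemma d_nonneg: "0 \<le> d X"
  by (simp add: cutdeg_def sum_nonneg)

lemma d_compl: "d (V - X) = d X"
  unfolding cutdeg_def by (rule sum.cong) (simp_all add: ends_in)

lemma d_Int_V: "d (X \<inter> V) = d X"
  unfolding cutdeg_def by (rule sum.cong) (simp_all add: ends_in)

lemma d_submod: "d (X \<inter> Y) + d (X \<union> Y) \<le> d X + d Y"
  unfolding cutdeg_def sum.distrib[symmetric]
  apply (rule sum_mono)
  subgoal for e
    by (cases "fst (ends e) \<in> X"; cases "fst (ends e) \<in> Y";
        cases "snd (ends e) \<in> X"; cases "snd (ends e) \<in> Y"; simp)
  done

lemma d_submod_diff: "d (X - Y) + d (Y - X) \<le> d X + d Y"
  unfolding cutdeg_def sum.distrib[symmetric]
  apply (rule sum_mono)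
  subgoal for e
    by (cases "fst (ends e) \<in> X"; cases "fst (ends e) \<in> Y";
        cases "snd (ends e) \<in> X"; cases "snd (ends e) \<in> Y"; simp)
  done

text \<open>Inserting \<open>t\<close> changes the cut by \<open>d {t}\<close> minus twice the
  number of edges between \<open>t\<close> and \<open>X\<close>.\<close>

lemma even_d_insert:
  assumes "t \<notin> X"
  shows "even (d (insert t X) + d {t} + d X)"
  unfolding cutdeg_def sum.distrib[symmetric]
proof (rule dvd_sum)
  fix e
  show "even (of_bool ((fst (ends e) \<in> insert t X) \<noteq> (snd (ends e) \<in> insert t X)) +
      of_bool ((fst (ends e) \<in> {t}) \<noteq> (snd (ends e) \<in> {t})) +
      (of_bool ((fst (ends e) \<in> X) \<noteq> (snd (ends e) \<in> X)) :: int))"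
    using assms by (cases "fst (ends e) = t"; cases "snd (ends e) = t"; simp add: of_bool_def)
qed

lemma even_d_Diff: "t \<in> X \<Longrightarrow> even (d (X - {t}) + d {t} + d X)"
  using even_d_insert[of t "X - {t}"]
  by (metis Diff_iff add.assoc add.commute insertI1 insert_Diff)

lemma even_d_evens:
  assumes "finite L" "L \<inter> odds = {}" "L \<subseteq> V" "L \<inter> X = {}"
  shows "even (d (X \<union> L) + d X)"
  using assms
proof (induction L)
  case (insert t L)
  have "even (d (insert t (X \<union> L)) + d {t} + d (X \<union> L))"
    using insert.hyps insert.prems by (intro even_d_insert) auto
  moreover have "even (d {t})" "even (d (X \<union> L) + d X)"
    using insert by (auto simp: odds_def)
  ultimately show ?case by simp
qed simp

section \<open>Local edge-connectivity through minimum cuts\<close>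

lemma lam_le: "x \<in> X \<Longrightarrow> y \<notin> X \<Longrightarrow> x \<in> V \<Longrightarrow> lam x y \<le> d X"
proof -
  assume "x \<in> X" "y \<notin> X" "x \<in> V"
  then have "lam x y \<le> d (X \<inter> V)"
    unfolding lam_def using finV by (intro Min_le) auto
  then show ?thesis by (simp add: d_Int_V)
qed

lemma lam_attained:
  assumes "x \<in> V" "x \<noteq> y"
  obtains X where "X \<subseteq> V" "x \<in> X" "y \<notin> X" "d X = lam x y"
proof -
  have "lam x y \<in> d ` {X. X \<subseteq> V \<and> x \<in> X \<and> y \<notin> X}"
    unfolding lam_def using finV assms by (intro Min_in) auto
  then obtain X where "lam x y = d X" "X \<in> {X. X \<subseteq> V \<and> x \<in> X \<and> y \<notin> X}" by (rule imageE)
  then show ?thesis by (intro that[of X]) simp_all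
qed

lemma lams_le_lam: "lams x y \<le> lam x y" "lam x y \<le> lams x y + 1" "even (lams x y)"
  unfolding lams_def by auto

lemma lams_le: "x \<in> X \<Longrightarrow> y \<notin> X \<Longrightarrow> x \<in> V \<Longrightarrow> lams x y \<le> d X"
  using lam_le[of x X y] lams_le_lam(1)[of x y] by linarith

lemma lams_ge: "even n \<Longrightarrow> n \<le> lam x y \<Longrightarrow> n \<le> lams x y"
  unfolding lams_def by presburger

text \<open>A minimum cut between \<open>x\<close> and \<open>z\<close> has \<open>y\<close> on one
  of its sides, so it also separates \<open>x\<close> from \<open>y\<close> or \<open>y\<close> from
  \<open>z\<close>. Evenness of \<open>n\<close> lets the bound survive the rounding in
  \<open>lams\<close>.\<close>

lemma lams_trans:
  assumes "x \<in> V" "y \<in> V" "x \<noteq> z" "n \<le> lams x y" "n \<le> lams y z" "even n"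
  shows "n \<le> lams x z"
proof (rule lams_ge)
  obtain X where X: "X \<subseteq> V" "x \<in> X" "z \<notin> X" "d X = lam x z"
    using lam_attained[of x z] assms by blast
  show "n \<le> lam x z"
  proof (cases "y \<in> X")
    case True
    then have "lams y z \<le> d X" using X assms by (intro lams_le) auto
    then show ?thesis using X assms by linarith
  next
    case False
    then have "lams x y \<le> d X" using X assms by (intro lams_le) auto
    then show ?thesis using X assms by linarith
  qed
qed fact

lemma lam_commute: "x \<in> V \<Longrightarrow> y \<in> V \<Longrightarrow> lam x y = lam y x"
proof -
  have *: "lam x y \<le> lam y x" if "x \<in> V" "y \<in> V" for x y
  proof (cases "x = y")
    case False
    then obtain X where "X \<subseteq> V" "y \<in> X" "x \<notin> X" "d X = lam y x"
      using lam_attained[of y x] \<open>y \<in> V\<close> by blast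
    then show ?thesis using lam_le[of x "V - X" y] that by (simp add: d_compl)
  qed simp
  show "x \<in> V \<Longrightarrow> y \<in> V \<Longrightarrow> ?thesis" by (simp add: * antisym)
qed

lemma lams_commute: "x \<in> V \<Longrightarrow> y \<in> V \<Longrightarrow> lams x y = lams y x"
  by (simp add: lams_def lam_commute)

section \<open>The requirement function and its skew-supermodularity\<close>

lemma R_ge: "x \<in> X \<Longrightarrow> x \<in> V \<Longrightarrow> y \<in> V \<Longrightarrow> y \<notin> X \<Longrightarrow> lams x y \<le> R X"
  unfolding R_def using finV by (intro Max_ge) auto

lemma R_nonneg: "0 \<le> R X"
  unfolding R_def using finV by (intro Max_ge) auto

lemma R_cases:
  obtains "R X = 0" | x y where "x \<in> X" "x \<in> V" "y \<in> V" "y \<notin> X" "R X = lams x y"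
proof -
  have "R X \<in> insert 0 ((\<lambda>(x, y). lams x y) ` ((X \<inter> V) \<times> (V - X)))"
    unfolding R_def using finV by (intro Max_in) auto
  then show ?thesis using that by auto
qed

lemma R_leI:
  assumes "0 \<le> n" "\<And>x y. x \<in> X \<Longrightarrow> x \<in> V \<Longrightarrow> y \<in> V \<Longrightarrow> y \<notin> X \<Longrightarrow> lams x y \<le> n"
  shows "R X \<le> n"
  by (rule R_cases[of X]) (use assms in auto)

lemma even_R: "even (R X)"
  by (rule R_cases[of X]) (simp_all add: lams_le_lam)

lemma R_le_d: "R X \<le> d X"
  by (rule R_leI) (auto simp: d_nonneg lams_le)

lemma R_compl: "R (V - X) = R X"
proof (rule antisym)
  show "R (V - X) \<le> R X"
  proof (rule R_leI)
    fix x y assume "x \<in> V - X" "x \<in> V" "y \<in> V" "y \<notin> V - X"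
    then show "lams x y \<le> R X" using R_ge[of y X x] lams_commute[of x y] by simp
  qed (rule R_nonneg)
  show "R X \<le> R (V - X)"
  proof (rule R_leI)
    fix x y assume "x \<in> X" "x \<in> V" "y \<in> V" "y \<notin> X"
    then show "lams x y \<le> R (V - X)" using R_ge[of y "V - X" x] lams_commute[of x y] by simp
  qed (rule R_nonneg)
qed

lemma R_Un: "R (X \<union> Y) \<le> max (R X) (R Y)"
proof (rule R_leI)
  fix x y assume *: "x \<in> X \<union> Y" "x \<in> V" "y \<in> V" "y \<notin> X \<union> Y"
  have "lams x y \<le> R X" if "x \<in> X" by (rule R_ge) (use * that in auto)
  moreover have "lams x y \<le> R Y" if "x \<in> Y" by (rule R_ge) (use * that in auto)
  ultimately show "lams x y \<le> max (R X) (R Y)" using *(1) by (auto simp: max_def)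
qed (use R_nonneg[of X] in linarith)

text \<open>Each of \<open>X\<close>, \<open>Y\<close>, \<open>V - X\<close>, \<open>V - Y\<close>
  is the union of two of the four regions cut out by \<open>X\<close> and \<open>Y\<close>. Thus
  \<open>R_Un\<close> bounds \<open>R X\<close> and \<open>R Y\<close> twice each, and the four
  bounds combine by arithmetic alone.\<close>

lemma R_skew:
  assumes "X \<subseteq> V" "Y \<subseteq> V"
  shows "R X + R Y \<le> R (X \<inter> Y) + R (X \<union> Y) \<or> R X + R Y \<le> R (X - Y) + R (Y - X)"
proof -
  have 1: "R X \<le> max (R (X \<inter> Y)) (R (X - Y))"
    using R_Un[of "X \<inter> Y" "X - Y"] by (simp only: Int_Diff_Un)
  have 2: "R Y \<le> max (R (X \<inter> Y)) (R (Y - X))"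
    using R_Un[of "Y \<inter> X" "Y - X"] unfolding Int_Diff_Un by (simp add: Int_commute)
  have *: "V - X = (V - (X \<union> Y)) \<union> (Y - X)" "V - Y = (V - (X \<union> Y)) \<union> (X - Y)"
    using assms by auto
  have 3: "R X \<le> max (R (X \<union> Y)) (R (Y - X))"
    using R_Un[of "V - (X \<union> Y)" "Y - X", folded *] by (simp only: R_compl)
  have 4: "R Y \<le> max (R (X \<union> Y)) (R (X - Y))"
    using R_Un[of "V - (X \<union> Y)" "X - Y", folded *] by (simp only: R_compl)
  show ?thesis using 1 2 3 4 by linarith
qed

lemma split_compl:
  assumes "pairing m" "X \<subseteq> V"
  shows "split m (V - X) = split m X"
proof -
  have "bij_betw m {v\<in>X. m v \<notin> X} {v\<in>V - X. m v \<notin> V - X}"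
    by (rule bij_betw_byWitness[where f' = m]) (use assms in \<open>auto simp: pairing_def\<close>)
  from bij_betw_same_card[OF this] show ?thesis unfolding split_def by (simp only:)
qed

lemma split_le_odds:
  assumes "pairing m" "X \<subseteq> V"
  shows "split m X \<le> int (card (X \<inter> odds))"
proof -
  have "{v\<in>X. m v \<notin> X} \<subseteq> X \<inter> odds"
  proof
    fix v assume "v \<in> {v\<in>X. m v \<notin> X}"
    then have "v \<in> X" "v \<in> V" "m v \<noteq> v" using assms(2) by auto
    then show "v \<in> X \<inter> odds" using assms(1) by (simp add: pairing_def odds_def)
  qed
  moreover have "finite (X \<inter> odds)" using assms finV finite_subset by auto
  ultimately show ?thesis unfolding split_def by (simp add: card_mono)
qed

end

section \<open>Contraction and gluing\<close>

text \<open>The edge set is kept: edges inside \<open>Y\<close> become loops at \<open>z\<close>,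
  invisible to \<open>cutdeg\<close>. The induction measure drops through the number of
  vertices.\<close>

definition contract :: "'v set \<Rightarrow> 'v \<Rightarrow> ('e \<Rightarrow> 'v \<times> 'v) \<Rightarrow> 'e \<Rightarrow> 'v \<times> 'v" where
  "contract Y z ends e = map_prod (\<lambda>v. if v \<in> Y then z else v) (\<lambda>v. if v \<in> Y then z else v) (ends e)"

lemma cutdeg_contract:
  "cutdeg E (contract Y z ends) X = cutdeg E ends {v. (if v \<in> Y then z else v) \<in> X}"
  by (simp add: cutdeg_def contract_def)

context mgraph
begin

text \<open>What remains of a feasible pairing of the graph in which \<open>V - A\<close> is contracted to \<open>z\<close>, stated
  in terms of the uncontracted graph.\<close>

definition half :: "('v \<Rightarrow> 'v) \<Rightarrow> 'v set \<Rightarrow> 'v \<Rightarrow> bool" where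
  "half m A z \<longleftrightarrow> (\<forall>v\<in>insert z A. m v \<in> insert z A \<and> m (m v) = v) \<and>
     (\<forall>v\<in>A. m v = v \<longleftrightarrow> even (d {v})) \<and> (m z = z \<longleftrightarrow> even (d A)) \<and>
     (\<forall>Z\<subseteq>A. split m Z + R Z \<le> d Z)"

lemma mgraph_contract:
  assumes "A \<subseteq> V" "z \<in> V - A"
  shows "mgraph (insert z A) E (contract (V - A) z ends)"
proof
  show "multigraph (insert z A) E (contract (V - A) z ends)"
    unfolding multigraph_def contract_def
    using assms finV finE ends_in by (auto intro: finite_subset)
qed

text \<open>Every cut of the contracted graph is a cut of the original one, so contraction cannot
  lower connectivity: subsets of \<open>A\<close> keep their \<open>d\<close>, while their
  \<open>R\<close> can only grow.\<close>

lemma half_contract: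
  assumes "A \<subseteq> V" "z \<in> V - A"
    and "mgraph.feasible (insert z A) E (contract (V - A) z ends) m"
  shows "half m A z"
proof -
  interpret C: mgraph "insert z A" E "contract (V - A) z ends"
    by (rule mgraph_contract) fact+
  have dC: "C.d Z = d Z" if "Z \<subseteq> A" for Z
  proof -
    have "{v. (if v \<in> V - A then z else v) \<in> Z} = Z" using that assms by auto
    then show ?thesis by (simp add: cutdeg_contract)
  qed
  have "{v. (if v \<in> V - A then z else v) \<in> {z}} = V - A" using assms by auto
  then have dz: "C.d {z} = d A"
    using d_compl[of A] by (simp only: cutdeg_contract)
  have lamC: "lam x y \<le> C.lam x (if y \<in> V - A then z else y)"
    if "x \<in> A" "y \<in> V" "x \<noteq> y" for x y
  proof -
    let ?c = "\<lambda>v. if v \<in> V - A then z else v"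
    have "x \<noteq> ?c y" using that assms by auto
    moreover have "x \<in> insert z A" using that by simp
    ultimately obtain X where X: "X \<subseteq> insert z A" "x \<in> X" "?c y \<notin> X" "C.d X = C.lam x (?c y)"
      using C.lam_attained[of x "?c y"] by metis
    have "lam x y \<le> d {v. ?c v \<in> X}"
      using X(2,3) that assms by (intro lam_le) auto
    then show ?thesis using X(4) by (simp only: cutdeg_contract)
  qed
  have RC: "R Z \<le> C.R Z" if "Z \<subseteq> A" for Z
  proof (rule R_leI)
    fix x y assume xy: "x \<in> Z" "x \<in> V" "y \<in> V" "y \<notin> Z"
    let ?y = "if y \<in> V - A then z else y"
    have "lam x y \<le> C.lam x ?y" using xy that by (intro lamC) auto
    then have "lams x y \<le> C.lams x ?y"
      using C.lams_ge[of "lams x y" x ?y] lams_le_lam(1,3)[of x y] by linarith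
    also have "\<dots> \<le> C.R Z" using xy that assms by (intro C.R_ge) auto
    finally show "lams x y \<le> C.R Z" .
  qed (rule C.R_nonneg)
  have "C.pairing m" and fe: "\<And>Z. Z \<subseteq> insert z A \<Longrightarrow> split m Z + C.R Z \<le> C.d Z"
    using assms(3) by (auto simp: C.feasible_def)
  then have "\<forall>v\<in>insert z A. m v \<in> insert z A \<and> m (m v) = v \<and> (m v = v \<longleftrightarrow> even (C.d {v}))"
    by (simp only: C.pairing_def)
  moreover have "split m Z + R Z \<le> d Z" if "Z \<subseteq> A" for Z
    using fe[of Z] dC[OF that] RC[OF that] that subset_insertI2[OF that, of z] by linarith
  moreover have "C.d {v} = d {v}" if "v \<in> A" for v using dC[of "{v}"] that by simp
  ultimately show ?thesis unfolding half_def using dz by (intro conjI ballI allI impI) auto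
qed

text \<open>The only pair of \<open>m\<close> not inside \<open>A\<close> is \<open>z\<close> with
  \<open>m z\<close>, present exactly when \<open>d A\<close> is odd. All other pairs split by
  \<open>Z\<close> are counted by the cardinality.\<close>

lemma half_split:
  assumes h: "half m A z" and A: "A \<subseteq> V" "z \<notin> A"
  shows "split m (A \<inter> Z) = int (card {v\<in>A \<inter> Z. m v \<in> A - Z}) + of_bool (odd (d A) \<and> m z \<in> Z)"
    and "split m (A - Z) = int (card {v\<in>A \<inter> Z. m v \<in> A - Z}) + of_bool (odd (d A) \<and> m z \<notin> Z)"
    and "odd (d A) \<Longrightarrow> m z \<in> A"
proof -
  have m: "m v \<in> insert z A" "m (m v) = v" if "v \<in> insert z A" for v
    using h that unfolding half_def by blast+
  have mz: "m z \<noteq> z \<longleftrightarrow> odd (d A)" using h unfolding half_def by blast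
  show mzA: "m z \<in> A" if "odd (d A)" using m[of z] mz that by auto
  have fin: "finite A" using A finV finite_subset by auto
  have eqz: "m v = z \<longleftrightarrow> odd (d A) \<and> v = m z" if "v \<in> A" for v
  proof
    assume "m v = z"
    then show "odd (d A) \<and> v = m z" using m(2)[of v] mz that A(2) by auto
  next
    assume "odd (d A) \<and> v = m z"
    then show "m v = z" using m(2)[of z] by simp
  qed
  have inA: "m v \<in> A" if "v \<in> A" "m v \<noteq> z" for v
    using m(1)[of v] that by simp
  have gen: "split m (A \<inter> Z) = int (card {v\<in>A \<inter> Z. m v \<in> A - Z}) + of_bool (odd (d A) \<and> m z \<in> Z)" for Z
  proof (cases "odd (d A) \<and> m z \<in> Z")
    case True
    have mmz: "m (m z) = z" by (rule m) simp
    have "v \<in> A \<inter> Z \<and> m v \<notin> A \<inter> Z \<longleftrightarrow> v = m z \<or> v \<in> A \<inter> Z \<and> m v \<in> A - Z" for v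
      using True mzA mmz A(2) inA[of v] eqz[of v] by (cases "v = m z"; cases "v \<in> A") auto
    then have "{v\<in>A \<inter> Z. m v \<notin> A \<inter> Z} = insert (m z) {v\<in>A \<inter> Z. m v \<in> A - Z}" by blast
    moreover have "m z \<notin> {v\<in>A \<inter> Z. m v \<in> A - Z}" using mmz A(2) by simp
    ultimately show ?thesis using True fin by (simp add: split_def)
  next
    case False
    have "v \<in> A \<inter> Z \<and> m v \<notin> A \<inter> Z \<longleftrightarrow> v \<in> A \<inter> Z \<and> m v \<in> A - Z" for v
      using False A(2) inA[of v] eqz[of v] by (cases "v \<in> A"; cases "v \<in> Z") auto
    then have "{v\<in>A \<inter> Z. m v \<notin> A \<inter> Z} = {v\<in>A \<inter> Z. m v \<in> A - Z}" by blast
    then show ?thesis using False by (auto simp: split_def)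
  qed
  show "split m (A \<inter> Z) = int (card {v\<in>A \<inter> Z. m v \<in> A - Z}) + of_bool (odd (d A) \<and> m z \<in> Z)"
    by (rule gen)
  \<comment> \<open>Counting the split pairs inside \<open>A\<close> from their other ends turns
    \<open>gen\<close> for the complement of \<open>Z\<close> into the claim about
    \<open>A - Z\<close>.\<close>
  have "m (m v) = v" if "v \<in> A" for v using m(2)[of v] that by simp
  then have "bij_betw m {v\<in>A \<inter> - Z. m v \<in> A - - Z} {v\<in>A \<inter> Z. m v \<in> A - Z}"
    by (intro bij_betw_byWitness[where f' = m]) auto
  from bij_betw_same_card[OF this] gen[of "- Z"]
  show "split m (A - Z) = int (card {v\<in>A \<inter> Z. m v \<in> A - Z}) + of_bool (odd (d A) \<and> m z \<notin> Z)"
    by (simp add: Diff_eq)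
qed

lemma half_split_odds:
  assumes h: "half m A z" and A: "A \<subseteq> V" and Z: "Z \<subseteq> A"
  shows "split m Z \<le> int (card (Z \<inter> odds))"
proof -
  have "{v\<in>Z. m v \<notin> Z} \<subseteq> Z \<inter> odds"
  proof
    fix v assume "v \<in> {v\<in>Z. m v \<notin> Z}"
    then have "v \<in> Z" "v \<in> A" "v \<in> V" "m v \<noteq> v" using A Z by auto
    then show "v \<in> Z \<inter> odds" using h by (simp add: half_def odds_def)
  qed
  moreover have "finite (Z \<inter> odds)" using A Z finV finite_subset by (metis finite_Int)
  ultimately show ?thesis unfolding split_def by (simp add: card_mono)
qed

text \<open>The partners of the two contraction vertices, if any, become partners of each other.\<close>

definition glue :: "('v \<Rightarrow> 'v) \<Rightarrow> 'v set \<Rightarrow> 'v \<Rightarrow> ('v \<Rightarrow> 'v) \<Rightarrow> 'v \<Rightarrow> 'v \<Rightarrow> 'v" where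
  "glue m1 A z1 m2 z2 v =
     (if v \<in> A then if m1 v = z1 then m2 z2 else m1 v
      else if m2 v = z2 then m1 z1 else m2 v)"

text \<open>Every pair of the glued map lies inside \<open>A\<close>, inside \<open>V - A\<close>,
  or consists of \<open>m1 z1\<close> and \<open>m2 z2\<close>. The first two counts are those of
  \<open>half_split\<close>, so that bounds for the two halves can be added.\<close>

lemma
  assumes A: "A \<subseteq> V" "z1 \<in> V - A" "z2 \<in> A"
    and h1: "half m1 A z1" and h2: "half m2 (V - A) z2"
  shows pairing_glue: "pairing (glue m1 A z1 m2 z2)"
    and split_glue: "Z \<subseteq> V \<Longrightarrow> split (glue m1 A z1 m2 z2) Z =
      int (card {v\<in>A \<inter> Z. m1 v \<in> A - Z}) + int (card {v\<in>(V - A) \<inter> Z. m2 v \<in> (V - A) - Z}) +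
      of_bool (odd (d A) \<and> (m1 z1 \<in> Z) \<noteq> (m2 z2 \<in> Z))"
proof -
  let ?m = "glue m1 A z1 m2 z2" and ?B = "V - A"
  have m1: "m1 v \<in> insert z1 A" "m1 (m1 v) = v" if "v \<in> insert z1 A" for v
    using h1 that unfolding half_def by blast+
  have m2: "m2 v \<in> insert z2 ?B" "m2 (m2 v) = v" if "v \<in> insert z2 ?B" for v
    using h2 that unfolding half_def by blast+
  have mz1: "m1 z1 \<noteq> z1 \<longleftrightarrow> odd (d A)" using h1 unfolding half_def by blast
  have mz2: "m2 z2 \<noteq> z2 \<longleftrightarrow> odd (d A)" using h2 d_compl[of A] unfolding half_def by metis
  have z: "z1 \<notin> A" "z2 \<notin> ?B" "z1 \<in> V" "z2 \<in> V" using A by auto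
  have e1: "m1 v = z1 \<longleftrightarrow> odd (d A) \<and> v = m1 z1" if "v \<in> A" for v
  proof
    assume "m1 v = z1"
    then show "odd (d A) \<and> v = m1 z1" using m1(2)[of v] mz1 that z by auto
  next
    assume "odd (d A) \<and> v = m1 z1"
    then show "m1 v = z1" using m1(2)[of z1] by simp
  qed
  have e2: "m2 v = z2 \<longleftrightarrow> odd (d A) \<and> v = m2 z2" if "v \<in> ?B" for v
  proof
    assume "m2 v = z2"
    then show "odd (d A) \<and> v = m2 z2" using m2(2)[of v] mz2 that z by auto
  next
    assume "odd (d A) \<and> v = m2 z2"
    then show "m2 v = z2" using m2(2)[of z2] by simp
  qed
  have q: "m1 z1 \<in> A" and p: "m2 z2 \<in> ?B" if "odd (d A)"
    using m1(1)[of z1] m2(1)[of z2] mz1 mz2 that by auto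
  have gA: "?m v = (if odd (d A) \<and> v = m1 z1 then m2 z2 else m1 v)" if "v \<in> A" for v
    using that e1 by (simp add: glue_def)
  have gB: "?m v = (if odd (d A) \<and> v = m2 z2 then m1 z1 else m2 v)" if "v \<in> ?B" for v
    using that e2[OF that] by (simp add: glue_def)
  have inA: "m1 v \<in> A" if "v \<in> A" "\<not> (odd (d A) \<and> v = m1 z1)" for v
    using m1(1)[of v] e1[of v] that by auto
  have inB: "m2 v \<in> ?B" if "v \<in> ?B" "\<not> (odd (d A) \<and> v = m2 z2)" for v
    using m2(1)[of v] e2[of v] that by auto
  have fin: "finite A" "finite ?B" using A finV finite_subset by auto
  show "pairing ?m" unfolding pairing_def
  proof
    fix v assume v: "v \<in> V"
    show "?m v \<in> V \<and> ?m (?m v) = v \<and> (?m v = v \<longleftrightarrow> even (d {v}))"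
    proof (cases "v \<in> A")
      case True
      have ev: "m1 v = v \<longleftrightarrow> even (d {v})" using h1 True by (simp add: half_def)
      show ?thesis
      proof (cases "odd (d A) \<and> v = m1 z1")
        case c: True
        have "m1 v \<noteq> v" using c m1(2)[of z1] z True by auto
        then show ?thesis using c True p gA gB[of "m2 z2"] ev by auto
      next
        case c: False
        have "m1 v \<in> A" by (rule inA) fact+
        moreover have "\<not> (odd (d A) \<and> m1 v = m1 z1)"
        proof
          assume "odd (d A) \<and> m1 v = m1 z1"
          then have "m1 (m1 v) = m1 (m1 z1)" by simp
          then have "v = z1" using m1(2)[of v] m1(2)[of z1] True by simp
          then show False using True z by simp
        qed
        ultimately have "?m v = m1 v" "?m (m1 v) = v"
          using gA[of v] gA[of "m1 v"] c True m1(2)[of v] by auto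
        then show ?thesis using ev A(1) \<open>m1 v \<in> A\<close> by auto
      qed
    next
      case False
      then have B: "v \<in> ?B" using v by simp
      have ev: "m2 v = v \<longleftrightarrow> even (d {v})" using h2 B by (simp add: half_def)
      show ?thesis
      proof (cases "odd (d A) \<and> v = m2 z2")
        case c: True
        have "m2 v \<noteq> v" using c m2(2)[of z2] z B by auto
        then show ?thesis using c B q gB[OF B] gA[of "m1 z1"] ev A(1) by auto
      next
        case c: False
        have "m2 v \<in> ?B" by (rule inB) fact+
        moreover have "\<not> (odd (d A) \<and> m2 v = m2 z2)"
        proof
          assume "odd (d A) \<and> m2 v = m2 z2"
          then have "m2 (m2 v) = m2 (m2 z2)" by simp
          then have "v = z2" using m2(2)[of v] m2(2)[of z2] B by simp
          then show False using B z by simp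
        qed
        ultimately have "?m v = m2 v" "?m (m2 v) = v"
          using gB[of v] gB[of "m2 v"] c B m2(2)[of v] by auto
        then show ?thesis using ev \<open>m2 v \<in> ?B\<close> by auto
      qed
    qed
  qed
  assume Z: "Z \<subseteq> V"
  let ?P1 = "{v\<in>A \<inter> Z. m1 v \<in> A - Z}" and ?P2 = "{v\<in>?B \<inter> Z. m2 v \<in> ?B - Z}"
  \<comment> \<open>\<open>?Q\<close> holds the end in \<open>Z\<close> of the glued pair if
    \<open>Z\<close> splits it, and is empty otherwise.\<close>
  let ?Q = "{v. odd (d A) \<and> (v = m1 z1 \<and> m1 z1 \<in> Z \<and> m2 z2 \<notin> Z \<or> v = m2 z2 \<and> m2 z2 \<in> Z \<and> m1 z1 \<notin> Z)}"
  have "v \<in> Z \<and> ?m v \<notin> Z \<longleftrightarrow> v \<in> ?P1 \<union> ?P2 \<union> ?Q" for v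
  proof -
    consider "v \<in> A" | "v \<in> ?B" | "v \<notin> V" by auto
    then show ?thesis
    proof cases
      case 1
      show ?thesis
      proof (cases "odd (d A) \<and> v = m1 z1")
        case True
        then have "m1 v = z1" "v \<noteq> m2 z2" using 1 e1 p by auto
        then show ?thesis using 1 True gA[OF 1] z p by auto
      next
        case False
        then show ?thesis using 1 gA[OF 1] inA[OF 1] p by auto
      qed
    next
      case 2
      show ?thesis
      proof (cases "odd (d A) \<and> v = m2 z2")
        case True
        then have "m2 v = z2" "v \<noteq> m1 z1" using 2 e2 q by auto
        then show ?thesis using 2 True gB[OF 2] z q by auto
      next
        case False
        then show ?thesis using 2 gB[OF 2] inB[OF 2] q by auto
      qed
    next
      case 3
      then show ?thesis using Z p q A(1) by auto
    qed
  qed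
  then have "{v\<in>Z. ?m v \<notin> Z} = ?P1 \<union> ?P2 \<union> ?Q" by blast
  moreover have "card (?P1 \<union> ?P2 \<union> ?Q) = card ?P1 + card ?P2 + card ?Q"
  proof -
    have "finite ?P1" "finite ?P2" using fin by auto
    moreover have "finite ?Q" by (rule finite_subset[of _ "{m1 z1, m2 z2}"]) auto
    moreover have "?P1 \<inter> ?P2 = {}" by auto
    moreover have "(?P1 \<union> ?P2) \<inter> ?Q = {}"
    proof (cases "odd (d A)")
      case True
      have "m1 (m1 z1) = z1" "m2 (m2 z2) = z2" using m1 m2 by auto
      then show ?thesis using p[OF True] q[OF True] z by auto
    qed simp
    ultimately show ?thesis by (simp only: card_Un_disjoint finite_Un) 
  qed
  moreover have "int (card ?Q) = of_bool (odd (d A) \<and> (m1 z1 \<in> Z) \<noteq> (m2 z2 \<in> Z))"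
  proof (cases "odd (d A) \<and> (m1 z1 \<in> Z) \<noteq> (m2 z2 \<in> Z)")
    case True
    then have Q: "?Q = {if m1 z1 \<in> Z then m1 z1 else m2 z2}" by auto
    show ?thesis unfolding Q using True by simp
  next
    case False
    then have Q: "?Q = {}" by auto
    show ?thesis unfolding Q using False by simp
  qed
  ultimately show "split ?m Z = int (card ?P1) + int (card ?P2) +
      of_bool (odd (d A) \<and> (m1 z1 \<in> Z) \<noteq> (m2 z2 \<in> Z))"
    unfolding split_def by (simp only: of_nat_add)
qed

section \<open>Existence of feasible pairings\<close>

text \<open>A side with at most one vertex is excepted because contracting it yields no smaller
  graph.\<close>

definition no_tight :: bool where
  "no_tight \<longleftrightarrow> (\<forall>X\<subseteq>V. d X = R X \<longrightarrow> (\<exists>v. X \<subseteq> {v} \<or> V - X \<subseteq> {v}))"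

definition nbrs :: "'v set" where
  "nbrs = {s\<in>V. \<exists>u\<in>odds. u \<noteq> s \<and> (\<exists>e\<in>E. ends e = (s, u) \<or> ends e = (u, s))}"

text \<open>As \<open>d A\<close> is even, no pair joins \<open>A\<close> to its complement. For
  each \<open>Z\<close>, \<open>R_skew\<close> selects one of the two ways to uncross it with
  \<open>A\<close>; the bounds of the two halves at the resulting sets add up, and
  \<open>d A = R A\<close> cancels.\<close>

lemma feasible_glue_even:
  assumes A: "A \<subseteq> V" "z1 \<in> V - A" "z2 \<in> A"
    and h1: "half m1 A z1" and h2: "half m2 (V - A) z2"
    and tight: "d A = R A"
  shows "feasible (glue m1 A z1 m2 z2)"
  unfolding feasible_def
proof (intro conjI allI impI)
  show "pairing (glue m1 A z1 m2 z2)" by (rule pairing_glue) fact+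
  fix Z assume Z: "Z \<subseteq> V"
  let ?B = "V - A"
  let ?e1 = "int (card {v\<in>A \<inter> Z. m1 v \<in> A - Z})" and ?e2 = "int (card {v\<in>?B \<inter> Z. m2 v \<in> ?B - Z})"
  have ev: "even (d A)" "even (d ?B)" using tight even_R d_compl by auto
  have sp: "split (glue m1 A z1 m2 z2) Z = ?e1 + ?e2"
    using split_glue[OF A h1 h2 Z] ev by simp
  have s1: "split m1 (A \<inter> Z) = ?e1" "split m1 (A - Z) = ?e1"
    using half_split(1,2)[OF h1, of Z] A ev by auto
  have s2: "split m2 (?B \<inter> Z) = ?e2" "split m2 (?B - Z) = ?e2"
    using half_split(1,2)[OF h2, of Z] A ev by auto
  have b1: "split m1 W + R W \<le> d W" if "W \<subseteq> A" for W using h1 that unfolding half_def by blast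
  have b2: "split m2 W + R W \<le> d W" if "W \<subseteq> ?B" for W using h2 that unfolding half_def by blast
  have "V - (A \<union> Z) = ?B - Z" by auto
  then have U: "d (A \<union> Z) = d (?B - Z)" "R (A \<union> Z) = R (?B - Z)"
    using d_compl[of "A \<union> Z"] R_compl[of "A \<union> Z"] by auto
  have D: "Z - A = ?B \<inter> Z" using Z by auto
  have "R A + R Z \<le> R (A \<inter> Z) + R (A \<union> Z) \<or> R A + R Z \<le> R (A - Z) + R (Z - A)"
    by (rule R_skew) fact+
  then show "split (glue m1 A z1 m2 z2) Z + R Z \<le> d Z"
    using d_submod[of A Z] d_submod_diff[of A Z] b1[of "A \<inter> Z"] b1[of "A - Z"]
      b2[of "?B \<inter> Z"] b2[of "?B - Z"] tight
    unfolding sp s1 s2 U D by auto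
qed

text \<open>Submodularity at \<open>A\<close> and \<open>Z\<close> can miss the glued pair when \<open>Z\<close> splits it. In that case one of
  \<open>A - Z\<close>, \<open>Z - A\<close> (or of \<open>A \<inter> Z\<close>, \<open>V - (A \<union> Z)\<close>) has \<open>R\<close> smaller than \<open>R A\<close>, and \<open>K1\<close> or \<open>K2\<close> compensates.\<close>

lemma feasible_glue_odd:
  assumes A: "A \<subseteq> V" "z1 \<in> V - A" "z2 \<in> A"
    and h1: "half m1 A z1" and h2: "half m2 (V - A) z2"
    and dA: "d A = R A + 1"
    and K1: "\<And>W. W \<subseteq> A \<Longrightarrow> R W < R A \<Longrightarrow> 1 + int (card (W \<inter> odds)) + R (A - W) \<le> d (A - W)"
    and K2: "\<And>W. W \<subseteq> V - A \<Longrightarrow> R W < R A \<Longrightarrow>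
      1 + int (card (W \<inter> odds)) + R (V - A - W) \<le> d (V - A - W)"
  shows "feasible (glue m1 A z1 m2 z2)"
proof -
  let ?B = "V - A" and ?m = "glue m1 A z1 m2 z2"
  have pair: "pairing ?m" by (rule pairing_glue) fact+
  have od: "odd (d A)" "odd (d ?B)" using dA even_R d_compl by auto
  have q: "m1 z1 \<in> A" and p: "m2 z2 \<in> ?B"
    using half_split(3)[OF h1] half_split(3)[OF h2] A od by auto
  have b1: "split m1 W + R W \<le> d W" if "W \<subseteq> A" for W using h1 that unfolding half_def by blast
  have b2: "split m2 W + R W \<le> d W" if "W \<subseteq> ?B" for W using h2 that unfolding half_def by blast
  \<comment> \<open>Of the two ways to split the glued pair only the one with
    \<open>m2 z2 \<in> Z\<close> is treated; the other is its complement.\<close>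
  have main: "split ?m Z + R Z \<le> d Z" if Z: "Z \<subseteq> V" and pq: "m1 z1 \<notin> Z \<or> m2 z2 \<in> Z" for Z
  proof -
    let ?e1 = "int (card {v\<in>A \<inter> Z. m1 v \<in> A - Z})" and ?e2 = "int (card {v\<in>?B \<inter> Z. m2 v \<in> ?B - Z})"
    have sp: "split ?m Z = ?e1 + ?e2 + of_bool ((m1 z1 \<in> Z) \<noteq> (m2 z2 \<in> Z))"
      using split_glue[OF A h1 h2 Z] od by simp
    have s1: "split m1 (A \<inter> Z) = ?e1 + of_bool (m1 z1 \<in> Z)" "split m1 (A - Z) = ?e1 + of_bool (m1 z1 \<notin> Z)"
      using half_split(1,2)[OF h1, of Z] A od by auto
    have s2: "split m2 (?B \<inter> Z) = ?e2 + of_bool (m2 z2 \<in> Z)" "split m2 (?B - Z) = ?e2 + of_bool (m2 z2 \<notin> Z)"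
      using half_split(1,2)[OF h2, of Z] A od by auto
    have "V - (A \<union> Z) = ?B - Z" by auto
    then have U: "d (A \<union> Z) = d (?B - Z)" "R (A \<union> Z) = R (?B - Z)"
      using d_compl[of "A \<union> Z"] R_compl[of "A \<union> Z"] by auto
    have D: "Z - A = ?B \<inter> Z" using Z by auto
    have sub: "d (A \<inter> Z) + d (?B - Z) \<le> d A + d Z" "d (A - Z) + d (?B \<inter> Z) \<le> d A + d Z"
      using d_submod[of A Z] d_submod_diff[of A Z] unfolding U D by auto
    have skew: "R A + R Z \<le> R (A \<inter> Z) + R (?B - Z) \<or> R A + R Z \<le> R (A - Z) + R (?B \<inter> Z)"
      using R_skew[OF A(1) Z] unfolding U D .
    have bs: "split m1 (A \<inter> Z) + R (A \<inter> Z) \<le> d (A \<inter> Z)" "split m1 (A - Z) + R (A - Z) \<le> d (A - Z)"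
      "split m2 (?B \<inter> Z) + R (?B \<inter> Z) \<le> d (?B \<inter> Z)" "split m2 (?B - Z) + R (?B - Z) \<le> d (?B - Z)"
      by (rule b1 b2; blast)+
    show ?thesis
    proof (cases "R A + R Z \<le> R (A - Z) + R (?B \<inter> Z)")
      case True
      \<comment> \<open>The bounds at \<open>A - Z\<close> and \<open>?B \<inter> Z\<close> gain 1
        for \<open>m1 z1 \<notin> Z\<close> and 1 for \<open>m2 z2 \<in> Z\<close>. By
        \<open>pq\<close> this covers the glued pair and the 1 by which \<open>d A\<close> exceeds
        \<open>R A\<close>.\<close>
      then show ?thesis using bs sub dA pq unfolding sp s1 s2 by (auto split: if_splits)
    next
      case False
      then have i: "R A + R Z \<le> R (A \<inter> Z) + R (?B - Z)" using skew by blast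
      show ?thesis
      proof (cases "m1 z1 \<notin> Z \<and> m2 z2 \<in> Z")
        case False
        then show ?thesis using i bs sub dA pq unfolding sp s1 s2 by (auto split: if_splits)
      next
        case qp: True
        \<comment> \<open>The bounds at \<open>A \<inter> Z\<close> and \<open>?B - Z\<close> now
          fall short by 2. If neither \<open>R (A - Z)\<close> nor \<open>R (?B \<inter> Z)\<close>
          were below \<open>R A\<close>, the failure of the other uncrossing would put both below
          \<open>R Z\<close>; but a pair attaining \<open>R Z\<close> is separated by one of these
          sets or by \<open>A\<close>.\<close>
        have "R (A - Z) < R A \<or> R (?B \<inter> Z) < R A"
        proof (rule ccontr)
          assume "\<not> ?thesis"
          then have ge: "R A \<le> R (A - Z)" "R A \<le> R (?B \<inter> Z)" by auto
          then have gt: "R (A - Z) < R Z" "R (?B \<inter> Z) < R Z" using False by auto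
          show False
          proof (rule R_cases[of Z])
            assume "R Z = 0"
            then show False using gt R_nonneg[of "A - Z"] by simp
          next
            fix x y assume xy: "x \<in> Z" "x \<in> V" "y \<in> V" "y \<notin> Z" "R Z = lams x y"
            consider "x \<notin> A" | "x \<in> A" "y \<in> A" | "x \<in> A" "y \<notin> A" by blast
            then show False
            proof cases
              case 1
              then have "lams x y \<le> R (?B \<inter> Z)" using xy by (intro R_ge) auto
              then show False using gt xy by simp
            next
              case 2
              then have "lams y x \<le> R (A - Z)" using xy by (intro R_ge) auto
              then show False using gt xy lams_commute[of x y] by simp
            next
              case 3
              then have "lams x y \<le> R A" using xy by (intro R_ge) auto
              then show False using gt ge xy by simp
            qed
          qed
        qed
        then show ?thesis
        proof
          \<comment> \<open>Of the missing 2, \<open>K1\<close> supplies 1 directly; the other comes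
            from \<open>split m1 (A - Z)\<close>, which also counts \<open>m1 z1\<close>.\<close>
          assume lt: "R (A - Z) < R A"
          have "A - (A - Z) = A \<inter> Z" by auto
          then have "1 + int (card ((A - Z) \<inter> odds)) + R (A \<inter> Z) \<le> d (A \<inter> Z)"
            using K1[of "A - Z"] lt by auto
          moreover have "split m1 (A - Z) \<le> int (card ((A - Z) \<inter> odds))"
            by (rule half_split_odds[OF h1 A(1)]) auto
          ultimately show ?thesis using i bs(4) sub(1) dA qp unfolding sp s1 s2 by simp
        next
          assume lt: "R (?B \<inter> Z) < R A"
          have "?B - (?B \<inter> Z) = ?B - Z" by auto
          then have "1 + int (card ((?B \<inter> Z) \<inter> odds)) + R (?B - Z) \<le> d (?B - Z)"
            using K2[of "?B \<inter> Z"] lt by auto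
          moreover have "split m2 (?B \<inter> Z) \<le> int (card ((?B \<inter> Z) \<inter> odds))"
            by (rule half_split_odds[OF h2]) auto
          ultimately show ?thesis using i bs(1) sub(1) dA qp unfolding sp s1 s2 by simp
        qed
      qed
    qed
  qed
  show ?thesis unfolding feasible_def
  proof (intro conjI allI impI pair)
    fix Z assume Z: "Z \<subseteq> V"
    show "split ?m Z + R Z \<le> d Z"
    proof (cases "m1 z1 \<notin> Z \<or> m2 z2 \<in> Z")
      case True
      then show ?thesis using main Z by simp
    next
      case False
      then have "split ?m (V - Z) + R (V - Z) \<le> d (V - Z)" using p by (intro main) auto
      then show ?thesis using split_compl[OF pair Z] by (simp only: d_compl R_compl)
    qed
  qed
qed

section \<open>Cuts around odd vertices and their neighbours\<close>

lemma nbrsI: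
  assumes "e \<in> E" "ends e = (s, u) \<or> ends e = (u, s)" "u \<in> odds" "u \<noteq> s"
  shows "s \<in> nbrs"
proof -
  have "s \<in> V" using ends_in[OF assms(1)] assms(2) by auto
  then show ?thesis unfolding nbrs_def using assms by blast
qed

text \<open>All edges at \<open>t\<close> except loops end in \<open>nbrs\<close>, so the change of
  the cut on inserting \<open>t\<close> depends only on the trace of the set on
  \<open>nbrs\<close>.\<close>

lemma d_insert_agree:
  assumes "t \<in> odds" "t \<notin> P" "t \<notin> Q" "P \<inter> nbrs = Q \<inter> nbrs"
  shows "d (insert t P) + d Q = d (insert t Q) + d P"
  unfolding cutdeg_def sum.distrib[symmetric]
proof (rule sum.cong)
  fix e assume e: "e \<in> E"
  obtain a b where ab: "ends e = (a, b)" by (cases "ends e")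
  have 1: "b \<in> P \<longleftrightarrow> b \<in> Q" if "a = t" "b \<noteq> t"
  proof -
    have "b \<in> nbrs" by (rule nbrsI[OF e, of _ t]) (use ab that assms(1) in auto)
    then show ?thesis using assms(4) by blast
  qed
  have 2: "a \<in> P \<longleftrightarrow> a \<in> Q" if "b = t" "a \<noteq> t"
  proof -
    have "a \<in> nbrs" by (rule nbrsI[OF e, of _ t]) (use ab that assms(1) in auto)
    then show ?thesis using assms(4) by blast
  qed
  show "of_bool ((fst (ends e) \<in> insert t P) \<noteq> (snd (ends e) \<in> insert t P)) +
      of_bool ((fst (ends e) \<in> Q) \<noteq> (snd (ends e) \<in> Q)) =
      of_bool ((fst (ends e) \<in> insert t Q) \<noteq> (snd (ends e) \<in> insert t Q)) +
      (of_bool ((fst (ends e) \<in> P) \<noteq> (snd (ends e) \<in> P)) :: int)"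
    using assms(2,3) 1 2 ab by (cases "a = t"; cases "b = t") auto
qed simp

text \<open>This provides \<open>K1\<close> and \<open>K2\<close> of
  \<open>feasible_glue_odd\<close>. Since \<open>W\<close> avoids \<open>nbrs\<close>, dropping its
  even vertices from \<open>A\<close> does not bring \<open>d\<close> below \<open>d A\<close>, and
  each odd vertex dropped afterwards raises \<open>d\<close> by at least 1.\<close>

lemma remove_light_part:
  assumes nt: no_tight and ind: "nbrs \<inter> odds = {}"
    and A: "A \<subseteq> V" "d A = R A + 1" "a \<in> nbrs" "a \<in> A" "a' \<in> nbrs" "a' \<notin> A"
    and deg: "\<And>a. a \<in> nbrs \<Longrightarrow> d A < d {a}"
    and conn: "\<And>a a'. a \<in> nbrs \<Longrightarrow> a' \<in> nbrs \<Longrightarrow> a \<noteq> a' \<Longrightarrow> R A \<le> lams a a'"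
    and W: "W \<subseteq> A" "R W < R A"
  shows "1 + int (card (W \<inter> odds)) + R (A - W) \<le> d (A - W)"
proof -
  have nV: "nbrs \<subseteq> V" by (auto simp: nbrs_def)
  \<comment> \<open>A member of \<open>nbrs\<close> in \<open>W\<close> would be connected to
    \<open>a'\<close> with strength \<open>R A\<close>, more than \<open>R W\<close> allows.\<close>
  have Wn: "W \<inter> nbrs = {}"
  proof (rule ccontr)
    assume "W \<inter> nbrs \<noteq> {}"
    then obtain w where w: "w \<in> W" "w \<in> nbrs" by blast
    have "lams w a' \<le> R W" using w W A nV by (intro R_ge) auto
    moreover have "R A \<le> lams w a'" using w W A by (intro conn) auto
    ultimately show False using W by simp
  qed
  have "0 < R A" using W R_nonneg[of W] by simp
  then obtain x y where xy: "x \<in> A" "x \<in> V" "y \<in> V" "y \<notin> A" "R A = lams x y"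
    using R_cases[of A] by (metis less_irrefl)
  have xW: "x \<notin> W"
  proof
    assume "x \<in> W"
    then have "lams x y \<le> R W" using xy W by (intro R_ge) auto
    then show False using xy W by simp
  qed
  have RA: "R (A - W) \<le> R A"
  proof (rule R_leI)
    fix v w assume vw: "v \<in> A - W" "v \<in> V" "w \<in> V" "w \<notin> A - W"
    show "lams v w \<le> R A"
    proof (cases "w \<in> W")
      case True
      then have "lams w v \<le> R W" using vw by (intro R_ge) auto
      then show ?thesis using W lams_commute[of v w] vw by simp
    next
      case False
      then show ?thesis using vw by (intro R_ge) auto
    qed
  qed (rule R_nonneg)
  let ?L = "W - odds"
  have fin: "finite W" using W A finV by (meson finite_subset)
  \<comment> \<open>\<open>A - ?L\<close> still separates \<open>x\<close> from \<open>y\<close>, so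
    its \<open>d\<close> is at least the even number \<open>R A\<close>; being odd like
    \<open>d A\<close>, it is at least \<open>R A + 1\<close>.\<close>
  have base: "d A \<le> d (A - ?L)"
  proof -
    have "even (d ((A - ?L) \<union> ?L) + d (A - ?L))"
      using fin W A by (intro even_d_evens) auto
    moreover have "(A - ?L) \<union> ?L = A" using W by auto
    ultimately have "even (d A + d (A - ?L))" by simp
    moreover have "R A \<le> d (A - ?L)" unfolding xy(5) using xy xW by (intro lams_le) auto
    ultimately show ?thesis using A(2) even_R[of A] by presburger
  qed
  \<comment> \<open>\<open>d (A - {t})\<close> is even and at least \<open>R A\<close>. Equality
    would make \<open>A - {t}\<close> tight, hence equal to \<open>{a}\<close> by \<open>nt\<close>,
    against \<open>deg\<close>; so it is at least \<open>R A + 2\<close>.\<close>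
  have step: "d A + 1 \<le> d (A - {t})" if t: "t \<in> W \<inter> odds" for t
  proof (rule ccontr)
    assume less: "\<not> ?thesis"
    have "even (d (A - {t}) + d {t} + d A)" using t W by (intro even_d_Diff) auto
    moreover have "odd (d {t})" using t by (simp add: odds_def)
    moreover have "R A \<le> d (A - {t})" unfolding xy(5) using xy xW t by (intro lams_le) auto
    ultimately have "d (A - {t}) = R A" using less A(2) even_R[of A] by presburger
    moreover have "R A \<le> R (A - {t})" unfolding xy(5) using xy xW t by (intro R_ge) auto
    ultimately have "d (A - {t}) = R (A - {t})" using R_le_d[of "A - {t}"] by simp
    moreover have "A - {t} \<subseteq> V" using A by auto
    ultimately obtain v where v: "A - {t} \<subseteq> {v} \<or> V - (A - {t}) \<subseteq> {v}"
      using nt unfolding no_tight_def by blast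
    have "a \<in> A - {t}" using A t ind by auto
    moreover have "t \<in> V - (A - {t})" "a' \<in> V - (A - {t})" "a' \<noteq> t"
      using A t W nV by auto
    ultimately have "A - {t} = {a}" using v by blast
    then have "d {a} = R A" using \<open>d (A - {t}) = R A\<close> by simp
    then show False using deg[OF A(3)] A(2) by simp
  qed
  have "finite (W \<inter> odds)" using fin by simp
  moreover have "d A + int (card T) \<le> d (A - ?L - T)" if "finite T" "T \<subseteq> W \<inter> odds" for T
    using that
  proof (induction T)
    case empty
    then show ?case using base by simp
  next
    case (insert t T)
    let ?P = "A - ?L - insert t T"
    have tt: "t \<in> W" "t \<in> odds" "t \<in> A" "t \<notin> T" using insert W by auto
    \<comment> \<open>All sets of the chain have the trace of \<open>A\<close> on
      \<open>nbrs\<close>, so removing \<open>t\<close> changes \<open>d\<close> as it does for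
      \<open>A\<close> itself.\<close>
    have "d (insert t ?P) + d (A - {t}) = d (insert t (A - {t})) + d ?P"
      using tt insert.prems Wn by (intro d_insert_agree) auto
    moreover have "insert t ?P = A - ?L - T" "insert t (A - {t}) = A" using tt by auto
    moreover have "d A + int (card T) \<le> d (A - ?L - T)" using insert by auto
    moreover have "d A + 1 \<le> d (A - {t})" using step tt by simp
    moreover have "card (insert t T) = Suc (card T)" using insert.hyps by simp
    ultimately show ?case by simp
  qed
  ultimately have "d A + int (card (W \<inter> odds)) \<le> d (A - ?L - W \<inter> odds)" by blast
  moreover have "A - ?L - W \<inter> odds = A - W" by auto
  ultimately show ?thesis using RA A(2) by simp
qed

end

lemma finite_minimizer:
  fixes f :: "'a \<Rightarrow> int"
  assumes "finite S" "S \<noteq> {}"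
  obtains x where "x \<in> S" "\<And>y. y \<in> S \<Longrightarrow> f x \<le> f y"
proof -
  have "Min (f ` S) \<in> f ` S" using assms by (intro Min_in) auto
  then obtain x where x: "Min (f ` S) = f x" "x \<in> S" by (rule imageE)
  have "f x \<le> f y" if "y \<in> S" for y
    unfolding x(1)[symmetric] using assms that by (intro Min_le) auto
  then show ?thesis using that x(2) by blast
qed

context mgraph
begin

section \<open>Deleting an edge at an odd vertex\<close>

lemma mgraph_delete: "mgraph V (E - {e}) ends"
  by standard (use multigraph in \<open>auto simp: multigraph_def\<close>)

lemma d_delete:
  assumes "e \<in> E" "ends e = (s, u) \<or> ends e = (u, s)"
  shows "d X = cutdeg (E - {e}) ends X + of_bool ((s \<in> X) \<noteq> (u \<in> X))"
proof -
  have "d X = of_bool ((fst (ends e) \<in> X) \<noteq> (snd (ends e) \<in> X)) + cutdeg (E - {e}) ends X"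
    unfolding cutdeg_def by (rule sum.remove) (use finE assms in auto)
  then show ?thesis using assms(2) by auto
qed

text \<open>If \<open>lams x y\<close> drops, a minimum cut \<open>X\<close> after the deletion is
  crossed by \<open>e\<close> and satisfies \<open>d X = R X = lams x y\<close> before it. By
  \<open>no_tight\<close> it isolates \<open>x\<close> or \<open>y\<close>; this vertex is an end of
  \<open>e\<close> of even degree, hence \<open>s\<close>.\<close>

lemma delete_lams:
  assumes nt: no_tight and e: "e \<in> E" "ends e = (s, u) \<or> ends e = (u, s)" "u \<in> odds"
    and xy: "x \<in> V" "y \<in> V" "x \<noteq> y"
    and less: "mgraph.lams V (E - {e}) ends x y < lams x y"
  shows "(x = s \<or> y = s) \<and> lams x y = d {s} \<and> R {s} = d {s}"
proof -
  interpret G: mgraph V "E - {e}" ends by (rule mgraph_delete)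
  obtain X where X: "X \<subseteq> V" "x \<in> X" "y \<notin> X" "G.d X = G.lam x y"
    using G.lam_attained[of x y] xy by metis
  have dX: "d X = G.d X + of_bool ((s \<in> X) \<noteq> (u \<in> X))" by (rule d_delete) fact+
  have "lams x y \<le> d X" using X xy by (intro lams_le) auto
  moreover have "G.lams x y + 2 \<le> lams x y"
    using less G.lams_le_lam(3)[of x y] lams_le_lam(3)[of x y] by presburger
  moreover have "G.lam x y \<le> G.lams x y + 1" by (rule G.lams_le_lam)
  ultimately have eq: "lams x y = d X" and sep: "(s \<in> X) \<noteq> (u \<in> X)"
    using dX X(4) by (cases "(s \<in> X) \<noteq> (u \<in> X)"; simp)+
  have "lams x y \<le> R X" using X xy by (intro R_ge) auto
  then have tight: "d X = R X" using eq R_le_d[of X] by simp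
  have odd: "odd (d {u})" using e by (simp add: odds_def)
  obtain v where "X \<subseteq> {v} \<or> V - X \<subseteq> {v}" using nt tight X(1) unfolding no_tight_def by blast
  then have "X = {x} \<or> V - X = {y}" using X xy by auto
  then have "\<exists>w. (w = x \<or> w = y) \<and> (X = {w} \<or> V - X = {w})" by metis
  then obtain w where w: "w = x \<or> w = y" "X = {w} \<or> V - X = {w}" by (elim exE conjE)
  have dw: "d {w} = d X" "R {w} = R X" using w(2) d_compl[of X] R_compl[of X] by auto
  have "w \<noteq> u" using dw tight odd even_R[of X] by auto
  moreover have "s \<in> V" using ends_in[OF e(1)] e(2) by auto
  moreover have "u \<in> V" using e by (simp add: odds_def)
  moreover have "(\<forall>v\<in>V. v \<in> X \<longleftrightarrow> v = w) \<or> (\<forall>v\<in>V. v \<in> X \<longleftrightarrow> v \<noteq> w)"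
    using w(2) by blast
  ultimately have "w = s" using sep by metis
  then show ?thesis using w(1) dw tight eq by (elim disjE) simp_all
qed

text \<open>Deleting \<open>e\<close> makes \<open>u\<close> even, so \<open>u\<close> is free to
  take over the partner \<open>w\<close> of \<open>s\<close>. A set splitting \<open>u\<close> from
  \<open>w\<close> splits \<open>s\<close> from \<open>w\<close> or \<open>s\<close> from
  \<open>u\<close>, and in the latter case \<open>e\<close> adds 1 to its cut.\<close>

lemma delete_pairing:
  assumes e: "e \<in> E" "ends e = (s, u) \<or> ends e = (u, s)" "u \<in> odds" "s \<noteq> u"
    and m': "mgraph.feasible V (E - {e}) ends m'"
  obtains m where "pairing m"
    "\<And>X. X \<subseteq> V \<Longrightarrow> split m X + mgraph.R V (E - {e}) ends X \<le> d X"
proof -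
  interpret G: mgraph V "E - {e}" ends by (rule mgraph_delete)
  have dX: "d X = G.d X + of_bool ((s \<in> X) \<noteq> (u \<in> X))" for X by (rule d_delete) fact+
  have sV: "s \<in> V" using ends_in[OF e(1)] e(2) by auto
  have uV: "u \<in> V" and odd: "odd (d {u})" using e by (auto simp: odds_def)
  have mV: "m' v \<in> V" and mm: "m' (m' v) = v" and me: "m' v = v \<longleftrightarrow> even (G.d {v})" if "v \<in> V" for v
    using m' that unfolding G.feasible_def G.pairing_def by blast+
  have mu: "m' u = u" using me[OF uV] odd dX[of "{u}"] e(4) by auto
  have par: "even (d {v}) \<longleftrightarrow> m' v = v" if "v \<in> V" "v \<noteq> s" "v \<noteq> u" for v
    using me[of v] dX[of "{v}"] that by auto
  have pars: "even (d {s}) \<longleftrightarrow> m' s \<noteq> s" using me[OF sV] dX[of "{s}"] e(4) by auto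
  have fe: "split m' X + G.R X \<le> G.d X" if "X \<subseteq> V" for X
    using m' that unfolding G.feasible_def by blast
  define w where "w = m' s"
  have w: "w \<in> V" "m' w = s" "m' s = w" "w \<noteq> u"
  proof -
    show "m' s = w" "w \<in> V" "m' w = s" using mV[OF sV] mm[OF sV] by (simp_all add: w_def)
    then show "w \<noteq> u" using mu e(4) by auto
  qed
  have inj: "m' v \<noteq> s" "m' v \<noteq> u" "m' v \<noteq> w" if "v \<in> V" "v \<noteq> s" "v \<noteq> u" "v \<noteq> w" for v
    using mm[OF that(1)] w mu that by metis+
  \<comment> \<open>If \<open>s\<close> is odd in the full graph, then \<open>w = s\<close> and the
    last update pairs \<open>s\<close> with \<open>u\<close>; otherwise \<open>s\<close> becomes a
    fixed point.\<close>
  define m where "m = m'(s := s, u := w, w := u)"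
  have m: "m u = w" "m w = u" "s \<noteq> w \<Longrightarrow> m s = s"
    "v \<noteq> s \<Longrightarrow> v \<noteq> u \<Longrightarrow> v \<noteq> w \<Longrightarrow> m v = m' v" for v
    using w e(4) by (auto simp: m_def)
  have "pairing m" unfolding pairing_def
  proof
    fix v assume v: "v \<in> V"
    consider "v = u" | "v = w" | "v = s" "s \<noteq> w" | "v \<noteq> u" "v \<noteq> w" "v \<noteq> s" by blast
    then show "m v \<in> V \<and> m (m v) = v \<and> (m v = v \<longleftrightarrow> even (d {v}))"
    proof cases
      case 1
      then show ?thesis using m w odd by simp
    next
      case 2
      have "odd (d {w})"
      proof (cases "w = s")
        case True
        then show ?thesis using pars w by simp
      next
        case False
        then show ?thesis using par[of w] w by simp
      qed
      then show ?thesis using 2 m w uV by simp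
    next
      case 3
      then show ?thesis using m(3) sV pars w by simp
    next
      case 4
      then have "m v = m' v" "m (m' v) = m' (m' v)" using m(4) inj v by auto
      then show ?thesis using mV[OF v] mm[OF v] par[OF v] 4 by simp
    qed
  qed
  moreover have "split m X + G.R X \<le> d X" if X: "X \<subseteq> V" for X
  proof -
    \<comment> \<open>\<open>?D\<close> collects the split vertices of unchanged pairs;
      \<open>?Q\<close> and \<open>?Q'\<close> hold the end in \<open>X\<close>, if split, of the
      pair \<open>u\<close>, \<open>w\<close> of \<open>m\<close> and of the pair \<open>s\<close>,
      \<open>w\<close> of \<open>m'\<close>.\<close>
    let ?D = "{v\<in>X - {s, u, w}. m' v \<notin> X}"
    have "finite X" using X finV by (rule finite_subset)
    then have fin: "finite X" "finite ?D" by simp_all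
    let ?Q = "{v. (v = u \<or> v = w) \<and> v \<in> X \<and> ((u \<in> X) \<noteq> (w \<in> X))}"
    let ?Q' = "{v. (v = s \<or> v = w) \<and> v \<in> X \<and> ((s \<in> X) \<noteq> (w \<in> X))}"
    have "v \<in> X \<and> m v \<notin> X \<longleftrightarrow> v \<in> ?D \<union> ?Q" for v
    proof -
      consider "v = u" | "v = w" | "v = s" "s \<noteq> w" | "v \<noteq> u" "v \<noteq> w" "v \<noteq> s" by blast
      then show ?thesis by cases (use m w e(4) in auto)
    qed
    then have "{v\<in>X. m v \<notin> X} = ?D \<union> ?Q" by blast
    moreover have "card (?D \<union> ?Q) \<le> card ?D + card ?Q" by (rule card_Un_le)
    moreover have "card ?Q = of_bool ((u \<in> X) \<noteq> (w \<in> X))"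
    proof (cases "(u \<in> X) \<noteq> (w \<in> X)")
      case True
      then have Q: "?Q = {if u \<in> X then u else w}" by auto
      show ?thesis unfolding Q using True by simp
    next
      case False
      then have Q: "?Q = {}" by auto
      show ?thesis unfolding Q using False by simp
    qed
    ultimately have "card {v\<in>X. m v \<notin> X} \<le> card ?D + of_bool ((u \<in> X) \<noteq> (w \<in> X))"
      by (simp only:)
    then have "int (card {v\<in>X. m v \<notin> X}) \<le> int (card ?D + of_bool ((u \<in> X) \<noteq> (w \<in> X)))"
      by (simp only: of_nat_le_iff)
    then have 1: "split m X \<le> int (card ?D) + of_bool ((u \<in> X) \<noteq> (w \<in> X))"
      by (simp only: split_def of_nat_add of_nat_of_bool)
    have "?D \<union> ?Q' \<subseteq> {v\<in>X. m' v \<notin> X}" using w by auto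
    then have "card (?D \<union> ?Q') \<le> card {v\<in>X. m' v \<notin> X}" using fin by (intro card_mono) auto
    moreover have "card (?D \<union> ?Q') = card ?D + card ?Q'"
      by (rule card_Un_disjoint) (use fin in auto)
    moreover have "card ?Q' = of_bool ((s \<in> X) \<noteq> (w \<in> X))"
    proof (cases "(s \<in> X) \<noteq> (w \<in> X)")
      case True
      then have Q: "?Q' = {if s \<in> X then s else w}" by auto
      show ?thesis unfolding Q using True by simp
    next
      case False
      then have Q: "?Q' = {}" by auto
      show ?thesis unfolding Q using False by simp
    qed
    ultimately have "card ?D + of_bool ((s \<in> X) \<noteq> (w \<in> X)) \<le> card {v\<in>X. m' v \<notin> X}"
      by (simp only:)
    then have "int (card ?D + of_bool ((s \<in> X) \<noteq> (w \<in> X))) \<le> int (card {v\<in>X. m' v \<notin> X})"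
      by (simp only: of_nat_le_iff)
    then have "int (card ?D) + of_bool ((s \<in> X) \<noteq> (w \<in> X)) \<le> split m' X"
      by (simp only: split_def of_nat_add of_nat_of_bool)
    then show ?thesis using 1 fe[OF X] dX[of X] by (cases "s \<in> X"; cases "u \<in> X"; cases "w \<in> X") auto
  qed
  ultimately show ?thesis by (rule that)
qed

text \<open>Only sets whose \<open>R\<close> drops with the deletion are critical. Such a set
  containing \<open>s\<close> meets \<open>nbrs\<close> in \<open>s\<close> alone, which forces its
  \<open>d\<close> up to \<open>d {s}\<close> plus the number of its odd vertices.\<close>

lemma delete_feasible:
  assumes nt: no_tight and ind: "nbrs \<inter> odds = {}"
    and e: "e \<in> E" "ends e = (s, u) \<or> ends e = (u, s)" "u \<in> odds" "s \<noteq> u" "s \<in> nbrs"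
    and conn: "\<And>a. a \<in> nbrs \<Longrightarrow> a \<noteq> s \<Longrightarrow> d {s} \<le> lams a s"
    and m': "mgraph.feasible V (E - {e}) ends m'"
  shows "\<exists>m. feasible m"
proof -
  interpret G: mgraph V "E - {e}" ends by (rule mgraph_delete)
  obtain m where pair: "pairing m" and le: "\<And>X. X \<subseteq> V \<Longrightarrow> split m X + G.R X \<le> d X"
    using delete_pairing[OF e(1-4) m'] by blast
  have sV: "s \<in> V" using e by (simp add: nbrs_def)
  have main: "split m X + R X \<le> d X" if X: "X \<subseteq> V" "s \<in> X" for X
  proof (cases "R X \<le> G.R X")
    case True
    then show ?thesis using le[OF X(1)] by simp
  next
    case False
    then have "R X \<noteq> 0" using G.R_nonneg[of X] by auto
    then obtain x y where xy: "x \<in> X" "x \<in> V" "y \<in> V" "y \<notin> X" "R X = lams x y"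
      using R_cases[of X] by metis
    have "G.lams x y \<le> G.R X" using xy by (intro G.R_ge) auto
    then have lt: "G.lams x y < lams x y" using False xy by simp
    have xney: "x \<noteq> y" using xy by auto
    have xs: "x = s" "lams x y = d {s}" "lams s y = d {s}"
      using delete_lams[OF nt e(1-3) xy(2,3) xney lt] X xy by auto
    \<comment> \<open>For another \<open>a\<close> of \<open>nbrs\<close> in \<open>X\<close>,
      transitivity gives \<open>d {s} \<le> lams a y\<close>. The deletion lowers
      \<open>lams\<close> only at \<open>s\<close>, so \<open>G.R X\<close> would still reach
      \<open>R X\<close>.\<close>
    have Xn: "X \<inter> nbrs = {s}"
    proof (rule ccontr)
      assume "X \<inter> nbrs \<noteq> {s}"
      then obtain a where a: "a \<in> X" "a \<in> nbrs" "a \<noteq> s" using X e by auto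
      have ne: "a \<noteq> y" "y \<noteq> s" using a xy X by auto
      have aV: "a \<in> V" using a by (simp add: nbrs_def)
      have "even (d {s})" using xs(2) lams_le_lam(3)[of x y] by simp
      then have big: "d {s} \<le> lams a y"
        using conn[OF a(2,3)] xs aV sV ne by (intro lams_trans[of a s y]) auto
      have "\<not> G.lams a y < lams a y"
        using delete_lams[OF nt e(1-3) aV xy(3) ne(1)] a ne by blast
      moreover have "G.lams a y \<le> G.R X" using a xy aV by (intro G.R_ge) auto
      ultimately show False using big xs False xy by simp
    qed
    have yX: "y \<notin> X" "s \<noteq> y" using xy X by auto
    let ?L = "X - odds"
    have s_odd: "s \<notin> odds" using ind e by auto
    \<comment> \<open>\<open>{s, t}\<close> separates \<open>s\<close> from \<open>y\<close>, so its
      cut is at least \<open>d {s}\<close>; equality is excluded by parity, \<open>d {t}\<close>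
      being odd.\<close>
    have step: "d {s} + 1 \<le> d (insert t {s})" if t: "t \<in> X \<inter> odds" for t
    proof -
      have ts: "t \<noteq> s" using t s_odd by auto
      have "lams s y \<le> d (insert t {s})" using t yX sV by (intro lams_le) auto
      then have "d {s} \<le> d (insert t {s})" using xs(3) by simp
      moreover have "even (d (insert t {s}) + d {t} + d {s})"
        using ts by (intro even_d_insert) auto
      moreover have "odd (d {t})" using t by (simp add: odds_def)
      ultimately have "d (insert t {s}) \<noteq> d {s}" "d {s} \<le> d (insert t {s})" by auto
      then show ?thesis by simp
    qed
    have "finite X" using X finV finite_subset by auto
    moreover have "d {s} + int (card T) \<le> d (?L \<union> T)" if "finite T" "T \<subseteq> X \<inter> odds" for T
      using that
    proof (induction T)
      case empty
      have "lams s y \<le> d ?L" using X yX sV s_odd by (intro lams_le) auto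
      then show ?case using xs(3) by simp
    next
      case (insert t T)
      have tt: "t \<in> X" "t \<in> odds" "t \<notin> T" "t \<noteq> s" using insert s_odd by auto
      have "d (insert t (?L \<union> T)) + d {s} = d (insert t {s}) + d (?L \<union> T)"
      proof (rule d_insert_agree)
        have "(?L \<union> T) \<inter> nbrs \<subseteq> X \<inter> nbrs" using insert.prems by auto
        moreover have "s \<in> ?L" "s \<in> nbrs" using X s_odd e by auto
        ultimately show "(?L \<union> T) \<inter> nbrs = {s} \<inter> nbrs" using Xn by auto
      qed (use tt in auto)
      moreover have "d {s} + int (card T) \<le> d (?L \<union> T)" using insert by auto
      moreover have "d {s} + 1 \<le> d (insert t {s})" using step tt by blast
      moreover have "int (card (insert t T)) = int (card T) + 1" using insert.hyps by simp
      ultimately have "d {s} + int (card (insert t T)) \<le> d (insert t (?L \<union> T))" by linarith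
      then show ?case by (simp only: Un_insert_right)
    qed
    ultimately have "d {s} + int (card (X \<inter> odds)) \<le> d (?L \<union> X \<inter> odds)" by blast
    moreover have "?L \<union> X \<inter> odds = X" by auto
    moreover have "split m X \<le> int (card (X \<inter> odds))" by (rule split_le_odds) fact+
    ultimately show ?thesis using xs xy by simp
  qed
  have "split m X + R X \<le> d X" if X: "X \<subseteq> V" for X
  proof (cases "s \<in> X")
    case True
    then show ?thesis using main X by simp
  next
    case False
    then have "split m (V - X) + R (V - X) \<le> d (V - X)" using sV by (intro main) auto
    then show ?thesis using split_compl[OF pair X] by (simp only: d_compl R_compl)
  qed
  then show ?thesis using pair unfolding feasible_def by blast
qed

end

section \<open>The induction that produces a feasible pairing\<close>

theorem pairing_exists:
  fixes V :: "'v set" and E :: "'e set" and ends :: "'e \<Rightarrow> 'v \<times> 'v"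
  assumes "mgraph V E ends"
  shows "\<exists>m. mgraph.feasible V E ends m"
  using assms
proof (induction "card V + card E" arbitrary: V E ends rule: less_induct)
  case less
  interpret mgraph V E ends by fact
  have IH: "\<exists>m. mgraph.feasible V' E' ends' m"
    if "card V' + card E' < card V + card E" "mgraph V' E' ends'"
    for V' :: "'v set" and E' :: "'e set" and ends' :: "'e \<Rightarrow> 'v \<times> 'v"
    using less.hyps that by blast
  have half_ex: "\<exists>m. half m A z" if A: "A \<subseteq> V" "z \<in> V - A" "\<not> V - A \<subseteq> {z}" for A z
  proof -
    have "insert z A \<subset> V" using A by auto
    then have "card (insert z A) < card V" using finV by (rule psubset_card_mono[rotated])
    then obtain m where "mgraph.feasible (insert z A) E (contract (V - A) z ends) m"
      using IH[OF _ mgraph_contract[OF A(1,2)]] by auto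
    then show ?thesis using half_contract[OF A(1,2)] by blast
  qed
  have halves: "\<exists>z1 z2 m1 m2. z1 \<in> V - A \<and> z2 \<in> A \<and> half m1 A z1 \<and> half m2 (V - A) z2"
    if A: "A \<subseteq> V" "\<And>v. \<not> A \<subseteq> {v}" "\<And>v. \<not> V - A \<subseteq> {v}" for A
  proof -
    obtain z1 z2 where z: "z1 \<in> V - A" "z2 \<in> A" using A(2,3) by blast
    have "V - (V - A) = A" using A(1) by auto
    then have "\<exists>m. half m (V - A) z2" using half_ex[of "V - A" z2] z A by auto
    moreover have "\<exists>m. half m A z1" using half_ex[of A z1] z A by auto
    ultimately show ?thesis using z by blast
  qed
  show ?case
  proof (rule ccontr)
    assume contra: "\<not> ?thesis"
    have nt: no_tight
    proof (rule ccontr)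
      assume "\<not> no_tight"
      then obtain A where A: "A \<subseteq> V" "d A = R A" "\<And>v. \<not> A \<subseteq> {v}" "\<And>v. \<not> V - A \<subseteq> {v}"
        unfolding no_tight_def by blast
      then show False using halves[OF A(1,3,4)] feasible_glue_even[OF A(1)] contra by metis
    qed
    have del: "\<exists>m. mgraph.feasible V (E - {e}) ends m" if "e \<in> E" for e
    proof -
      have "card (E - {e}) < card E" using finE that by (rule card_Diff1_less)
      then show ?thesis by (intro IH mgraph_delete) auto
    qed
    have nbr_edge: "\<exists>u e. e \<in> E \<and> (ends e = (s, u) \<or> ends e = (u, s)) \<and> u \<in> odds \<and> s \<noteq> u" if "s \<in> nbrs" for s
      using that unfolding nbrs_def by blast
    \<comment> \<open>Otherwise, by \<open>delete_lams\<close>, deleting \<open>e\<close> lowers no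
      \<open>lams\<close>, and the map given by \<open>delete_pairing\<close> is feasible.\<close>
    have tight: "R {s} = d {s}" if s: "s \<in> nbrs" for s
    proof (rule ccontr)
      assume ne: "R {s} \<noteq> d {s}"
      obtain u e where e: "e \<in> E" "ends e = (s, u) \<or> ends e = (u, s)" "u \<in> odds" "s \<noteq> u"
        using nbr_edge[OF s] by blast
      obtain m' where m': "mgraph.feasible V (E - {e}) ends m'" using del e by blast
      interpret G: mgraph V "E - {e}" ends by (rule mgraph_delete)
      obtain m where pair: "pairing m" and le: "\<And>X. X \<subseteq> V \<Longrightarrow> split m X + G.R X \<le> d X"
        using delete_pairing[OF e m'] by blast
      have "R X \<le> G.R X" for X
      proof (rule R_leI)
        fix x y assume xy: "x \<in> X" "x \<in> V" "y \<in> V" "y \<notin> X"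
        have "x \<noteq> y" using xy by auto
        then have "lams x y \<le> G.lams x y"
          using delete_lams[OF nt e(1-3) xy(2,3)] ne by (meson not_less)
        also have "\<dots> \<le> G.R X" by (rule G.R_ge) fact+
        finally show "lams x y \<le> G.R X" .
      qed (rule G.R_nonneg)
      then have "split m X + R X \<le> d X" if "X \<subseteq> V" for X
        using le[OF that] by (meson add_left_mono order_trans)
      then show False using contra pair unfolding feasible_def by blast
    qed
    have nV: "nbrs \<subseteq> V" by (auto simp: nbrs_def)
    have ind: "nbrs \<inter> odds = {}"
    proof (rule ccontr)
      assume "nbrs \<inter> odds \<noteq> {}"
      then obtain v where "v \<in> nbrs" "v \<in> odds" by blast
      then show False using tight[of v] even_R[of "{v}"] by (simp add: odds_def)
    qed
    have "odds \<noteq> {}"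
    proof
      assume "odds = {}"
      then have "feasible id" using R_le_d by (auto simp: feasible_def pairing_def split_def odds_def)
      then show False using contra by blast
    qed
    then obtain u where u: "u \<in> odds" by blast
    have "nbrs \<noteq> {}"
    proof
      assume none: "nbrs = {}"
      have "d {u} = 0" unfolding cutdeg_def
      proof (rule sum.neutral, rule ballI)
        fix e assume e: "e \<in> E"
        obtain a b where ab: "ends e = (a, b)" by (cases "ends e")
        have "b = u" if "a = u" using nbrsI[OF e, of b u] none u ab that by auto
        moreover have "a = u" if "b = u" using nbrsI[OF e, of a u] none u ab that by auto
        ultimately show "of_bool ((fst (ends e) \<in> {u}) \<noteq> (snd (ends e) \<in> {u})) = (0::int)"
          using ab by auto
      qed
      then show False using u by (simp add: odds_def)
    qed
    moreover have "finite nbrs" using nV finV finite_subset by blast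
    ultimately obtain s where s: "s \<in> nbrs" and min: "\<And>a. a \<in> nbrs \<Longrightarrow> d {s} \<le> d {a}"
      using finite_minimizer[of nbrs "\<lambda>v. d {v}"] by blast
    define Q where "Q = {A. A \<subseteq> V \<and> nbrs \<inter> A \<noteq> {} \<and> nbrs - A \<noteq> {} \<and> d A = R A + 1 \<and> d A < d {s}}"
    \<comment> \<open>A set with \<open>d A = R A\<close> would isolate \<open>a\<close> or
      \<open>a'\<close>, whose degree is at least \<open>d {s}\<close>.\<close>
    have small: "A \<in> Q" if A: "A \<subseteq> V" "a \<in> nbrs" "a \<in> A" "a' \<in> nbrs" "a' \<notin> A" "d A \<le> R A + 1" "d A < d {s}"
      for A a a'
    proof -
      have "d A \<noteq> R A"
      proof
        assume "d A = R A"
        then obtain v where "A \<subseteq> {v} \<or> V - A \<subseteq> {v}" using nt A(1) unfolding no_tight_def by blast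
        then have "A = {a} \<or> V - A = {a'}" using A nV by blast
        then have "d A = d {a} \<or> d A = d {a'}" using d_compl[of A] by metis
        then show False using min[OF A(2)] min[OF A(4)] A(7) by linarith
      qed
      then have "d A = R A + 1" using A(6) R_le_d[of A] by simp
      then show ?thesis using A unfolding Q_def by blast
    qed
    \<comment> \<open>A minimum cut \<open>X\<close> has \<open>d X \<le> R X + 1\<close>, since
      \<open>lams\<close> rounds off at most 1; so \<open>X\<close> is in \<open>Q\<close> or
      \<open>d X \<ge> d {s}\<close>. This is applied with \<open>n = d {s}\<close> if
      \<open>Q\<close> is empty, and with \<open>n = R A\<close> for a minimal \<open>A\<close> in
      \<open>Q\<close> otherwise.\<close>
    have conn: "n \<le> lams a a'"
      if n: "even n" "n \<le> d {s}" "\<And>A. A \<in> Q \<Longrightarrow> n \<le> d A" and a: "a \<in> nbrs" "a' \<in> nbrs" "a \<noteq> a'" for n a a'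
    proof (rule lams_ge)
      obtain X where X: "X \<subseteq> V" "a \<in> X" "a' \<notin> X" "d X = lam a a'"
        using lam_attained[of a a'] a nV by blast
      have "lams a a' \<le> R X" using X a nV by (intro R_ge) auto
      then have "d X \<le> R X + 1" using X(4) lams_le_lam(2)[of a a'] by simp
      then have "d X < d {s} \<Longrightarrow> X \<in> Q" using small[OF X(1) a(1) X(2) a(2) X(3)] by blast
      then show "n \<le> lam a a'" using n(2) n(3)[of X] X(4) by (cases "d X < d {s}") auto
    qed fact
    show False
    proof (cases "Q = {}")
      case True
      obtain u e where e: "e \<in> E" "ends e = (s, u) \<or> ends e = (u, s)" "u \<in> odds" "s \<noteq> u"
        using nbr_edge[OF s] by blast
      obtain m' where m': "mgraph.feasible V (E - {e}) ends m'" using del e by blast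
      have "even (d {s})" using tight[OF s] even_R[of "{s}"] by simp
      then have "d {s} \<le> lams a s" if "a \<in> nbrs" "a \<noteq> s" for a
        using that s True by (intro conn) auto
      then show False using delete_feasible[OF nt ind e s _ m'] contra by blast
    next
      case False
      moreover have "finite Q" unfolding Q_def using finV by simp
      ultimately obtain A where AQ: "A \<in> Q" and Amin: "\<And>B. B \<in> Q \<Longrightarrow> d A \<le> d B"
        using finite_minimizer[of Q d] by blast
      obtain a a' where A: "A \<subseteq> V" "d A = R A + 1" "a \<in> nbrs" "a \<in> A" "a' \<in> nbrs" "a' \<notin> A" "d A < d {s}"
        using AQ unfolding Q_def by blast
      have deg: "d A < d {v}" if "v \<in> nbrs" for v using A(7) min[OF that] by simp
      have cA: "R A \<le> lams v w" if "v \<in> nbrs" "w \<in> nbrs" "v \<noteq> w" for v w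
      proof (rule conn)
        show "R A \<le> d B" if "B \<in> Q" for B using Amin[OF that] A(2) by simp
      qed (use A that even_R in auto)
      have nt1: "\<not> A \<subseteq> {v}" for v
      proof
        assume "A \<subseteq> {v}"
        then have "A = {a}" using A(4) by auto
        then show False using deg[OF A(3)] by simp
      qed
      have nt2: "\<not> V - A \<subseteq> {v}" for v
      proof
        assume "V - A \<subseteq> {v}"
        then have "V - A = {a'}" using A nV by auto
        then show False using deg[OF A(5)] d_compl[of A] by simp
      qed
      obtain z1 z2 m1 m2 where z: "z1 \<in> V - A" "z2 \<in> A" and h: "half m1 A z1" "half m2 (V - A) z2"
        using halves[OF A(1) nt1 nt2] by blast
      have "feasible (glue m1 A z1 m2 z2)"
      proof (rule feasible_glue_odd[OF A(1) z h A(2)])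
        show "1 + int (card (W \<inter> odds)) + R (A - W) \<le> d (A - W)" if "W \<subseteq> A" "R W < R A" for W
          by (rule remove_light_part[OF nt ind A(1-6) deg cA that])
        \<comment> \<open>The situation is symmetric under complement, with \<open>a\<close> and
          \<open>a'\<close> exchanged.\<close>
        have dB: "d (V - A) = d A" "R (V - A) = R A" by (rule d_compl R_compl)+
        show "1 + int (card (W \<inter> odds)) + R (V - A - W) \<le> d (V - A - W)"
          if "W \<subseteq> V - A" "R W < R A" for W
        proof (rule remove_light_part[OF nt ind, of _ a' a])
          show "\<And>v. v \<in> nbrs \<Longrightarrow> d (V - A) < d {v}" using deg unfolding dB .
          show "\<And>v w. v \<in> nbrs \<Longrightarrow> w \<in> nbrs \<Longrightarrow> v \<noteq> w \<Longrightarrow> R (V - A) \<le> lams v w"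
            using cA unfolding dB .
        qed (use A nV that dB in auto)
      qed
      then show False using contra by blast
    qed
  qed
qed

section \<open>Balanced orientations and Menger's theorem\<close>

text \<open>Net number of arcs leaving \<open>X\<close>. Unlike \<open>outdeg\<close> it is a
  difference of vertex terms, so it telescopes along trails and changes sign when arcs are
  reversed.\<close>

definition excess :: "'e set \<Rightarrow> ('e \<Rightarrow> 'v \<times> 'v) \<Rightarrow> 'v set \<Rightarrow> int" where
  "excess F a X = (\<Sum>e\<in>F. of_bool (fst (a e) \<in> X) - of_bool (snd (a e) \<in> X))"

definition outdeg :: "'e set \<Rightarrow> ('e \<Rightarrow> 'v \<times> 'v) \<Rightarrow> 'v set \<Rightarrow> int" where
  "outdeg F a X = (\<Sum>e\<in>F. of_bool (fst (a e) \<in> X \<and> snd (a e) \<notin> X))"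

text \<open>Two edges \<open>ab\<close> and \<open>bc\<close> are replaced by \<open>ac\<close>.\<close>

lemma balanced_orientation:
  assumes "finite E" "\<And>v. even (cutdeg E ends {v})"
  shows "\<exists>ori. \<forall>X. excess E (arc ends ori) X = 0"
  using assms
proof (induction "card E" arbitrary: E ends rule: less_induct)
  case less
  note fin = less.prems(1)
  consider "E = {}" | e where "e \<in> E" "fst (ends e) = snd (ends e)"
    | e a b where "e \<in> E" "ends e = (a, b)" "a \<noteq> b"
    by (metis ex_in_conv prod.collapse)
  then show ?case
  proof cases
    case 1
    then show ?thesis by (simp add: excess_def)
  next
    case (2 e)
    have "card (E - {e}) < card E" using fin 2(1) by (rule card_Diff1_less)
    moreover have "cutdeg (E - {e}) ends X = cutdeg E ends X" for X
      using 2 by (simp add: cutdeg_def sum.remove[OF fin 2(1)])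
    ultimately obtain ori where ori: "\<And>X. excess (E - {e}) (arc ends ori) X = 0"
      using less.hyps[of "E - {e}" ends] less.prems by auto
    have "excess E (arc ends ori) X = 0" for X
      using ori[of X] 2(2) by (simp add: excess_def sum.remove[OF fin 2(1)] arc_def)
    then show ?thesis by blast
  next
    case (3 e a b)
    \<comment> \<open>The degree of \<open>b\<close> is even and \<open>e\<close> contributes 1, so
      a second edge \<open>f\<close> that is not a loop meets \<open>b\<close>.\<close>
    have "odd (cutdeg (E - {e}) ends {b})"
    proof -
      have "cutdeg E ends {b} = 1 + cutdeg (E - {e}) ends {b}"
        using 3 by (simp add: cutdeg_def sum.remove[OF fin 3(1)])
      then show ?thesis using less.prems(2)[of b] by simp
    qed
    then have "cutdeg (E - {e}) ends {b} \<noteq> 0" by auto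
    then obtain f where f: "f \<in> E - {e}" "(fst (ends f) = b) \<noteq> (snd (ends f) = b)"
      unfolding cutdeg_def by (force elim: sum.not_neutral_contains_not_neutral)
    then obtain c where c: "c \<noteq> b" "ends f = (b, c) \<or> ends f = (c, b)"
      by (cases "ends f") auto
    \<comment> \<open>For \<open>c = a\<close> the merged edge is a loop.\<close>
    define ends' where "ends' = ends(e := (a, c))"
    let ?r = "E - {f} - {e}"
    have fE: "f \<in> E" "f \<noteq> e" "e \<in> E - {f}" "finite (E - {f})" using f 3 fin by auto
    have sE: "sum g E = g f + (g e + sum g ?r)" for g :: "'a \<Rightarrow> int"
      unfolding sum.remove[OF fin fE(1)] sum.remove[OF fE(4,3)] ..
    have sF: "sum g (E - {f}) = g e + sum g ?r" for g :: "'a \<Rightarrow> int"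
      by (rule sum.remove[OF fE(4,3)])
    have "card (E - {f}) < card E" using fin fE(1) by (rule card_Diff1_less)
    moreover have "even (cutdeg (E - {f}) ends' {v})" for v
    proof -
      let ?g = "\<lambda>x. of_bool ((fst (ends x) \<in> {v}) \<noteq> (snd (ends x) \<in> {v})) :: int"
      have r: "(\<Sum>x\<in>?r. of_bool ((fst (ends' x) \<in> {v}) \<noteq> (snd (ends' x) \<in> {v}))) = sum ?g ?r"
        by (rule sum.cong) (auto simp: ends'_def)
      have "cutdeg (E - {f}) ends' {v} = of_bool ((a = v) \<noteq> (c = v)) + sum ?g ?r"
        unfolding cutdeg_def sF r by (simp add: ends'_def)
      moreover have "cutdeg E ends {v} = of_bool ((b = v) \<noteq> (c = v)) + (of_bool ((a = v) \<noteq> (b = v)) + sum ?g ?r)"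
      proof -
        have "?g f = of_bool ((b = v) \<noteq> (c = v))"
          using c(2) by (elim disjE; cases "b = v"; cases "c = v"; simp)
        then show ?thesis unfolding cutdeg_def sE using 3(2) by simp
      qed
      moreover have "even (of_bool ((a = v) \<noteq> (c = v)) + of_bool ((b = v) \<noteq> (c = v))
          + of_bool ((a = v) \<noteq> (b = v)) :: int)"
        by (cases "a = v"; cases "b = v"; cases "c = v") simp_all
      ultimately show ?thesis using less.prems(2)[of v] by (simp only: even_add) argo
    qed
    ultimately obtain ori where ori: "\<And>X. excess (E - {f}) (arc ends' ori) X = 0"
      using less.hyps[of "E - {f}" ends'] fE(4) by blast
    \<comment> \<open>Both \<open>e\<close> and \<open>f\<close> follow the direction of the merged
      edge, so one enters \<open>b\<close> and the other leaves it.\<close>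
    define ori' where "ori' = ori(f := (ori e \<longleftrightarrow> ends f = (b, c)))"
    have "excess E (arc ends ori') X = 0" for X
    proof -
      let ?g = "\<lambda>x. of_bool (fst (arc ends ori x) \<in> X) - of_bool (snd (arc ends ori x) \<in> X) :: int"
      have r: "(\<Sum>x\<in>?r. of_bool (fst (arc ends ori' x) \<in> X) - of_bool (snd (arc ends ori' x) \<in> X)) = sum ?g ?r"
        by (rule sum.cong) (auto simp: ori'_def arc_def)
      have r': "(\<Sum>x\<in>?r. of_bool (fst (arc ends' ori x) \<in> X) - of_bool (snd (arc ends' ori x) \<in> X)) = sum ?g ?r"
        by (rule sum.cong) (auto simp: ends'_def arc_def)
      have "0 = excess (E - {f}) (arc ends' ori) X" using ori by simp
      also have "\<dots> = of_bool (fst (arc ends' ori e) \<in> X) - of_bool (snd (arc ends' ori e) \<in> X) + sum ?g ?r"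
        unfolding excess_def sF r' ..
      also have "arc ends' ori e = (if ori e then (a, c) else (c, a))"
        by (simp add: arc_def ends'_def)
      finally have 1: "0 = of_bool (fst (if ori e then (a, c) else (c, a)) \<in> X)
        - of_bool (snd (if ori e then (a, c) else (c, a)) \<in> X) + sum ?g ?r" .
      have ae: "arc ends ori' e = (if ori e then (a, b) else (b, a))"
        using 3(2) fE(2) by (simp add: arc_def ori'_def)
      have af: "arc ends ori' f = (if ori e then (b, c) else (c, b))"
        using c by (auto simp: arc_def ori'_def)
      show ?thesis unfolding excess_def sE r ae af using 1 by (cases "ori e") simp_all
    qed
    then show ?thesis by blast
  qed
qed

text \<open>The contributions of consecutive arcs telescope; distinctness turns the sum over the
  edge set into one over positions.\<close>

lemma excess_trail:
  assumes "distinct es" "length vs = Suc (length es)"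
    and "\<And>i. i < length es \<Longrightarrow> a (es ! i) = (vs ! i, vs ! Suc i)"
  shows "excess (set es) a X = of_bool (hd vs \<in> X) - of_bool (last vs \<in> X)"
proof -
  have "bij_betw ((!) es) {..<length es} (set es)"
    using assms(1) by (intro bij_betw_nth) auto
  then have "excess (set es) a X =
      (\<Sum>i<length es. of_bool (fst (a (es ! i)) \<in> X) - of_bool (snd (a (es ! i)) \<in> X))"
    unfolding excess_def by (rule sum.reindex_bij_betw[symmetric])
  also have "\<dots> = (\<Sum>i<length es. of_bool (vs ! i \<in> X) - of_bool (vs ! Suc i \<in> X))"
    by (rule sum.cong) (simp_all add: assms(3))
  also have "\<dots> = of_bool (vs ! 0 \<in> X) - of_bool (vs ! length es \<in> X)"
    by (rule sum_lessThan_telescope')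
  finally show ?thesis using assms(2) by (simp add: hd_conv_nth last_conv_nth flip: length_greater_0_conv)
qed

lemma even_excess_cutdeg: "even (excess F (arc ends ori) {v} + cutdeg F ends {v})"
  unfolding excess_def cutdeg_def sum.distrib[symmetric]
  by (rule dvd_sum) (auto simp: arc_def)

section \<open>Directed paths, flows and Menger's theorem for arcs\<close>

lemma distinct_dipath_edges:
  assumes "is_dipath E ends ori x y es vs"
  shows "distinct es"
  unfolding distinct_conv_nth
proof (intro allI impI)
  fix i j assume ij: "i < length es" "j < length es" "i \<noteq> j"
  have len: "length vs = Suc (length es)" and dv: "distinct vs"
    and arcs: "\<And>i. i < length es \<Longrightarrow> arc ends ori (es ! i) = (vs ! i, vs ! Suc i)"
    using assms by (auto simp: is_dipath_def)
  have "vs ! i \<noteq> vs ! j" using ij len dv by (simp add: nth_eq_iff_index_eq)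
  then show "es ! i \<noteq> es ! j" using arcs[OF ij(1)] arcs[OF ij(2)] by auto
qed

lemma excess_dipath:
  assumes "is_dipath E ends ori x y es vs"
  shows "excess (set es) (arc ends ori) X = of_bool (x \<in> X) - of_bool (y \<in> X)"
proof -
  have "excess (set es) (arc ends ori) X = of_bool (hd vs \<in> X) - of_bool (last vs \<in> X)"
    by (rule excess_trail) (use assms distinct_dipath_edges[OF assms] in \<open>auto simp: is_dipath_def\<close>)
  then show ?thesis using assms by (simp add: is_dipath_def)
qed

text \<open>A new vertex extends the path; a vertex already visited truncates it there, which keeps
  the vertices distinct.\<close>

lemma reachable_dipath:
  assumes "(x, y) \<in> (arc ends ori ` F)\<^sup>*"
  shows "\<exists>es vs. is_dipath F ends ori x y es vs"
  using assms
proof (induction rule: rtrancl_induct)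
  case base
  have "is_dipath F ends ori x x [] [x]" by (simp add: is_dipath_def)
  then show ?case by blast
next
  case (step y z)
  obtain es vs where p: "is_dipath F ends ori x y es vs" using step by blast
  obtain e where e: "e \<in> F" "arc ends ori e = (y, z)" using step(2) by auto
  have len: "length vs = Suc (length es)" and hd: "hd vs = x" and la: "last vs = y"
    and sub: "set es \<subseteq> F" and dv: "distinct vs"
    and arcs: "\<And>i. i < length es \<Longrightarrow> arc ends ori (es ! i) = (vs ! i, vs ! Suc i)"
    using p by (auto simp: is_dipath_def)
  show ?case
  proof (cases "z \<in> set vs")
    case True
    then obtain i where i: "i < length vs" "vs ! i = z" by (auto simp: in_set_conv_nth)
    have "is_dipath F ends ori x z (take i es) (take (Suc i) vs)"
      unfolding is_dipath_def
    proof (intro conjI allI impI)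
      show "length (take (Suc i) vs) = Suc (length (take i es))" using i len by simp
      show "hd (take (Suc i) vs) = x" using hd len by (cases vs) auto
      show "last (take (Suc i) vs) = z" using i by (simp add: take_Suc_conv_app_nth)
      show "set (take i es) \<subseteq> F" using sub by (meson order_trans set_take_subset)
      show "distinct (take (Suc i) vs)" using dv by simp
      show "arc ends ori (take i es ! j) = (take (Suc i) vs ! j, take (Suc i) vs ! Suc j)"
        if "j < length (take i es)" for j using that arcs[of j] by simp
    qed
    then show ?thesis by blast
  next
    case False
    have "is_dipath F ends ori x z (es @ [e]) (vs @ [z])"
      unfolding is_dipath_def
    proof (intro conjI allI impI)
      show "length (vs @ [z]) = Suc (length (es @ [e]))" using len by simp
      show "hd (vs @ [z]) = x" using hd len by (cases vs) auto
      show "set (es @ [e]) \<subseteq> F" using sub e by simp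
      show "distinct (vs @ [z])" using dv False by simp
      show "arc ends ori ((es @ [e]) ! j) = ((vs @ [z]) ! j, (vs @ [z]) ! Suc j)"
        if "j < length (es @ [e])" for j
      proof (cases "j < length es")
        case True
        then show ?thesis using arcs[of j] len by (simp add: nth_append)
      next
        case False
        then have j: "j = length es" using that by simp
        have "vs ! length es = y" using la len by (metis diff_Suc_1 last_conv_nth length_0_conv nat.distinct(1))
        then show ?thesis using j e len by (simp add: nth_append)
      qed
    qed simp
    then show ?thesis by blast
  qed
qed

lemma closed_under_steps:
  assumes "e \<in> F" "fst (a e) \<in> {v. (x, v) \<in> (a ` F)\<^sup>*}"
  shows "snd (a e) \<in> {v. (x, v) \<in> (a ` F)\<^sup>*}"
proof -
  have "(fst (a e), snd (a e)) \<in> a ` F" using assms(1) by simp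
  then show ?thesis using assms(2) by (auto intro: rtrancl_into_rtrancl)
qed

text \<open>Reversing a path from \<open>x\<close> to \<open>y\<close> lowers every cut separating \<open>x\<close> from \<open>y\<close> by exactly one; arcs
  used both by the path and by the flow in the reversed graph cancel.\<close>

lemma flow_exists:
  assumes "finite E" "\<And>X. x \<in> X \<Longrightarrow> y \<notin> X \<Longrightarrow> int k \<le> outdeg E (arc ends ori) X"
  shows "\<exists>F\<subseteq>E. \<forall>X. excess F (arc ends ori) X = int k * (of_bool (x \<in> X) - of_bool (y \<in> X))"
  using assms(2)
proof (induction k arbitrary: ori)
  case 0
  then show ?case by (intro exI[of _ "{}"]) (simp add: excess_def)
next
  case (Suc k)
  let ?a = "arc ends ori"
  have "(x, y) \<in> (?a ` E)\<^sup>*"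
  proof (rule ccontr)
    assume n: "(x, y) \<notin> (?a ` E)\<^sup>*"
    \<comment> \<open>No arc leaves the set reachable from \<open>x\<close>, so it would be a cut of
      \<open>outdeg\<close> 0.\<close>
    let ?X = "{v. (x, v) \<in> (?a ` E)\<^sup>*}"
    have "outdeg E ?a ?X = 0"
      unfolding outdeg_def by (rule sum.neutral) (use closed_under_steps[of _ E ?a x] in simp)
    then show False using Suc.prems[of ?X] n by simp
  qed
  from reachable_dipath[OF this] obtain es vs where p: "is_dipath E ends ori x y es vs"
    by (elim exE)
  define Q where "Q = set es"
  have QE: "Q \<subseteq> E" using p by (simp add: is_dipath_def Q_def)
  have excQ: "excess Q ?a X = of_bool (x \<in> X) - of_bool (y \<in> X)" for X
    unfolding Q_def by (rule excess_dipath) fact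
  define ori' where "ori' = (\<lambda>e. if e \<in> Q then \<not> ori e else ori e)"
  let ?b = "arc ends ori'"
  have ab: "?b e = (if e \<in> Q then (snd (?a e), fst (?a e)) else ?a e)" for e
    by (simp add: arc_def ori'_def)
  have finQ: "finite Q" by (simp add: Q_def)
  have "outdeg E ?b X + excess Q ?a X = outdeg E ?a X" for X
  proof -
    have "excess Q ?a X = (\<Sum>e\<in>E. if e \<in> Q then of_bool (fst (?a e) \<in> X) - of_bool (snd (?a e) \<in> X) else 0)"
      unfolding excess_def using QE assms(1) by (simp add: sum.If_cases Int_absorb1)
    then show ?thesis
      unfolding outdeg_def by (simp only: sum.distrib[symmetric]) (rule sum.cong, auto simp: ab)
  qed
  then have "int k \<le> outdeg E ?b X" if "x \<in> X" "y \<notin> X" for X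
    using Suc.prems[OF that] excQ[of X] that by (smt (verit) of_bool_eq of_nat_Suc)
  then obtain F where F: "F \<subseteq> E"
    and excF: "\<And>X. excess F ?b X = int k * (of_bool (x \<in> X) - of_bool (y \<in> X))"
    using Suc.IH[of ori'] by blast
  have finF: "finite F" using F assms(1) finite_subset by blast
  let ?G = "(F - Q) \<union> (Q - F)"
  have "excess ?G ?a X = int (Suc k) * (of_bool (x \<in> X) - of_bool (y \<in> X))" for X
  proof -
    let ?g = "\<lambda>e. of_bool (fst (?a e) \<in> X) - of_bool (snd (?a e) \<in> X) :: int"
    let ?h = "\<lambda>e. of_bool (fst (?b e) \<in> X) - of_bool (snd (?b e) \<in> X) :: int"
    have 1: "sum ?g ?G = sum ?g (F - Q) + sum ?g (Q - F)"
      by (rule sum.union_disjoint) (use finF finQ in auto)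
    have 2: "sum ?h F = sum ?h (F \<inter> Q) + sum ?h (F - Q)" using finF by (rule sum.Int_Diff)
    have 3: "sum ?g Q = sum ?g (Q \<inter> F) + sum ?g (Q - F)" using finQ by (rule sum.Int_Diff)
    have 4: "sum ?h (F - Q) = sum ?g (F - Q)" by (rule sum.cong) (simp_all add: ab)
    have 5: "sum ?h (F \<inter> Q) = - sum ?g (Q \<inter> F)"
      unfolding sum_negf[symmetric] by (rule sum.cong) (auto simp: ab)
    have "sum ?g ?G = sum ?h F + sum ?g Q" using 1 2 3 4 5 by simp
    then show ?thesis
      using excF[of X] excQ[of X] unfolding excess_def by (simp add: algebra_simps)
  qed
  moreover have "?G \<subseteq> E" using F QE by auto
  ultimately show ?case by blast
qed

text \<open>The condition says that \<open>F\<close> is a 0-1 flow of value \<open>k\<close>. A set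
  closed under the arcs of \<open>F\<close> has no positive excess, so \<open>y\<close> is reachable
  while \<open>k > 0\<close>; removing a path leaves a flow of value one less.\<close>

lemma flow_dipaths:
  assumes "finite F" "x \<noteq> y"
    and "\<And>X. excess F (arc ends ori) X = int k * (of_bool (x \<in> X) - of_bool (y \<in> X))"
  shows "\<exists>ps. length ps = k \<and> (\<forall>p\<in>set ps. is_dipath F ends ori x y (fst p) (snd p)) \<and>
    (\<forall>i<k. \<forall>j<k. i \<noteq> j \<longrightarrow> set (fst (ps ! i)) \<inter> set (fst (ps ! j)) = {})"
  using assms(1,3)
proof (induction k arbitrary: F)
  case 0
  then show ?case by simp
next
  case (Suc k)
  let ?a = "arc ends ori"
  have "(x, y) \<in> (?a ` F)\<^sup>*"
  proof (rule ccontr)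
    assume n: "(x, y) \<notin> (?a ` F)\<^sup>*"
    let ?X = "{v. (x, v) \<in> (?a ` F)\<^sup>*}"
    have "excess F ?a ?X \<le> 0"
      unfolding excess_def by (rule sum_nonpos) (use closed_under_steps[of _ F ?a x] in simp)
    then show False using Suc.prems(2)[of ?X] n by simp
  qed
  from reachable_dipath[OF this] obtain es vs where p: "is_dipath F ends ori x y es vs"
    by (elim exE)
  have sub: "set es \<subseteq> F" using p by (simp add: is_dipath_def)
  have "excess (F - set es) ?a X = int k * (of_bool (x \<in> X) - of_bool (y \<in> X))" for X
  proof -
    have "excess (F - set es) ?a X = excess F ?a X - excess (set es) ?a X"
      unfolding excess_def using Suc.prems(1) sub by (rule sum_diff)
    then show ?thesis using Suc.prems(2)[of X] excess_dipath[OF p, of X]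
      by (simp add: algebra_simps)
  qed
  with Suc.IH[of "F - set es"] Suc.prems(1) obtain ps where ps: "length ps = k"
    "\<forall>p\<in>set ps. is_dipath (F - set es) ends ori x y (fst p) (snd p)"
    "\<forall>i<k. \<forall>j<k. i \<noteq> j \<longrightarrow> set (fst (ps ! i)) \<inter> set (fst (ps ! j)) = {}"
    by (meson finite_Diff)
  have 1: "set (fst (ps ! i)) \<subseteq> F - set es" if "i < k" for i
    using bspec[OF ps(2), of "ps ! i"] ps(1) that by (simp add: is_dipath_def)
  have 2: "\<forall>i<Suc k. \<forall>j<Suc k. i \<noteq> j \<longrightarrow> set (fst (((es, vs) # ps) ! i)) \<inter> set (fst (((es, vs) # ps) ! j)) = {}"
  proof (intro allI impI)
    fix i j assume "i < Suc k" "j < Suc k" "i \<noteq> j"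
    then show "set (fst (((es, vs) # ps) ! i)) \<inter> set (fst (((es, vs) # ps) ! j)) = {}"
      using 1[of "i - 1"] 1[of "j - 1"] ps(3) by (cases i; cases j) auto
  qed
  have 3: "\<forall>p\<in>set ((es, vs) # ps). is_dipath F ends ori x y (fst p) (snd p)"
  proof
    fix p' assume "p' \<in> set ((es, vs) # ps)"
    then show "is_dipath F ends ori x y (fst p') (snd p')"
      using p bspec[OF ps(2), of p'] by (auto simp: is_dipath_def)
  qed
  have 4: "length ((es, vs) # ps) = Suc k" using ps(1) by simp
  show ?case by (rule exI[of _ "(es, vs) # ps"]) (rule conjI[OF 4 conjI[OF 3 2]])
qed

theorem directed_menger:
  assumes "finite E" "x \<noteq> y" "\<And>X. x \<in> X \<Longrightarrow> y \<notin> X \<Longrightarrow> int k \<le> outdeg E (arc ends ori) X"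
  shows "k_edge_disjoint (is_dipath E ends ori x y) k"
proof -
  have "\<exists>F\<subseteq>E. \<forall>X. excess F (arc ends ori) X = int k * (of_bool (x \<in> X) - of_bool (y \<in> X))"
    by (rule flow_exists[OF assms(1)]) (rule assms(3))
  then obtain F where F: "F \<subseteq> E"
    "\<forall>X. excess F (arc ends ori) X = int k * (of_bool (x \<in> X) - of_bool (y \<in> X))"
    by (elim exE conjE)
  have "finite F" using F(1) assms(1) by (rule finite_subset)
  from flow_dipaths[OF this assms(2) spec[OF F(2)]] obtain ps where ps: "length ps = k"
    "\<forall>p\<in>set ps. is_dipath F ends ori x y (fst p) (snd p)"
    "\<forall>i<k. \<forall>j<k. i \<noteq> j \<longrightarrow> set (fst (ps ! i)) \<inter> set (fst (ps ! j)) = {}"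
    by (elim exE conjE)
  have "\<forall>p\<in>set ps. is_dipath E ends ori x y (fst p) (snd p)"
    using ps(2) F(1) unfolding is_dipath_def by blast
  then show ?thesis unfolding k_edge_disjoint_def
    by (intro exI[of _ ps] conjI ps(1,3))
qed

section \<open>Edge-disjoint paths against cuts\<close>

lemma dipath_path: "is_dipath E ends ori x y es vs \<Longrightarrow> is_path E ends x y es vs"
  unfolding is_dipath_def is_path_def is_walk_def arc_def
  by (metis prod.collapse prod.inject)

lemma walk_crosses:
  assumes "is_walk E ends x y es vs" "x \<in> X" "y \<notin> X"
  shows "\<exists>e\<in>set es. e \<in> E \<and> (fst (ends e) \<in> X) \<noteq> (snd (ends e) \<in> X)"
proof (rule ccontr)
  assume n: "\<not> ?thesis"
  have len: "length vs = Suc (length es)" and hd: "hd vs = x" and la: "last vs = y"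
    and sub: "set es \<subseteq> E"
    and w: "\<And>i. i < length es \<Longrightarrow> ends (es ! i) = (vs ! i, vs ! Suc i) \<or> ends (es ! i) = (vs ! Suc i, vs ! i)"
    using assms(1) by (auto simp: is_walk_def)
  have "i \<le> length es \<Longrightarrow> vs ! i \<in> X" for i
  proof (induction i)
    case 0
    then show ?case using hd assms(2) len by (cases vs) auto
  next
    case (Suc i)
    then have i: "i < length es" "vs ! i \<in> X" by auto
    have "es ! i \<in> set es" using i(1) by simp
    then have "(fst (ends (es ! i)) \<in> X) = (snd (ends (es ! i)) \<in> X)" using n sub by blast
    then show ?case using w[OF i(1)] i(2) by auto
  qed
  then have "vs ! length es \<in> X" by simp
  then show False using la len assms(3) by (metis diff_Suc_1 last_conv_nth length_0_conv nat.distinct(1))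
qed

text \<open>Each path uses an edge of the cut, and disjointness makes the chosen edges
  distinct.\<close>

lemma disjoint_paths_le_cut:
  assumes "finite E" "k_edge_disjoint (is_path E ends x y) k" "x \<in> X" "y \<notin> X"
  shows "int k \<le> cutdeg E ends X"
proof -
  obtain ps where ps: "length ps = k" "\<And>p. p \<in> set ps \<Longrightarrow> is_path E ends x y (fst p) (snd p)"
    "\<And>i j. i < k \<Longrightarrow> j < k \<Longrightarrow> i \<noteq> j \<Longrightarrow> set (fst (ps ! i)) \<inter> set (fst (ps ! j)) = {}"
    using assms(2) unfolding k_edge_disjoint_def by blast
  let ?C = "{e\<in>E. (fst (ends e) \<in> X) \<noteq> (snd (ends e) \<in> X)}"
  have "\<forall>i. \<exists>e. i < k \<longrightarrow> e \<in> set (fst (ps ! i)) \<and> e \<in> ?C"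
  proof
    fix i
    show "\<exists>e. i < k \<longrightarrow> e \<in> set (fst (ps ! i)) \<and> e \<in> ?C"
    proof (cases "i < k")
      case True
      then have "is_walk E ends x y (fst (ps ! i)) (snd (ps ! i))"
        using ps(1) ps(2)[of "ps ! i"] by (simp add: is_path_def)
      from walk_crosses[OF this assms(3,4)] show ?thesis by blast
    qed simp
  qed
  from choice[OF this] obtain g where g: "\<forall>i. i < k \<longrightarrow> g i \<in> set (fst (ps ! i)) \<and> g i \<in> ?C"
    by (elim exE)
  have "inj_on g {..<k}"
  proof (rule inj_onI, rule ccontr)
    fix i j assume ij: "i \<in> {..<k}" "j \<in> {..<k}" "g i = g j" "i \<noteq> j"
    then have "g i \<in> set (fst (ps ! i))" "g i \<in> set (fst (ps ! j))"
      using g[rule_format, of i] g[rule_format, of j] by simp_all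
    then show False using ps(3)[of i j] ij by auto
  qed
  moreover have "g ` {..<k} \<subseteq> ?C" using g by auto
  ultimately have "card {..<k} \<le> card ?C" using assms(1) by (intro card_inj_on_le[of g]) auto
  also have "int (card ?C) = cutdeg E ends X"
    using assms(1) by (simp add: cutdeg_def of_bool_def sum.If_cases Int_def)
  finally show ?thesis by simp
qed

section \<open>Extending the orientation of a trail\<close>

text \<open>The cut is the sum, and the excess the difference, of the numbers of arcs leaving and
  entering \<open>X\<close>.\<close>

lemma outdeg_excess: "2 * outdeg E (arc ends ori) X = cutdeg E ends X + excess E (arc ends ori) X"
  unfolding outdeg_def cutdeg_def excess_def sum_distrib_left sum.distrib[symmetric]
  by (rule sum.cong) (auto simp: arc_def)

lemma excess_le_cutdeg: "excess F (arc ends ori) X \<le> cutdeg F ends X"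
  unfolding excess_def cutdeg_def by (rule sum_mono) (auto simp: arc_def)

lemma excess_reverse: "excess F (arc ends (\<lambda>e. \<not> ori e)) X = - excess F (arc ends ori) X"
  unfolding excess_def sum_negf[symmetric] by (rule sum.cong) (auto simp: arc_def)

context mgraph
begin

text \<open>The members of \<open>S\<close> serve as names of the added edges:
  \<open>v \<in> S\<close> stands for the edge from \<open>v\<close> to \<open>m v\<close>.\<close>

lemma pairing_representatives:
  assumes "pairing m"
  obtains S where "S \<subseteq> V" "\<And>v. v \<in> S \<Longrightarrow> m v \<noteq> v"
    "\<And>v. v \<in> V \<Longrightarrow> m v \<noteq> v \<Longrightarrow> v \<in> S \<longleftrightarrow> m v \<notin> S"
proof
  \<comment> \<open>The choice depends only on the set, so both members of a pair choose the same
    vertex.\<close>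
  define r where "r v = (SOME w. w \<in> {v, m v})" for v
  let ?S = "{v\<in>V. m v \<noteq> v \<and> r v = v}"
  show "?S \<subseteq> V" by auto
  show "m v \<noteq> v" if "v \<in> ?S" for v using that by simp
  show "v \<in> ?S \<longleftrightarrow> m v \<notin> ?S" if v: "v \<in> V" "m v \<noteq> v" for v
  proof -
    have m: "m v \<in> V" "m (m v) = v" using assms v by (auto simp: pairing_def)
    have "r (m v) = r v" unfolding r_def m(2) by (simp only: insert_commute)
    moreover have "r v \<in> {v, m v}" unfolding r_def by (rule someI[of _ v]) simp
    ultimately show ?thesis using m v by auto
  qed
qed

text \<open>Each odd vertex meets exactly one pair edge. Vertices outside \<open>V\<close> are
  included because \<open>balanced_orientation\<close> asks for evenness everywhere.\<close>

lemma even_cutdeg_representatives: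
  assumes m: "pairing m" and S: "S \<subseteq> V" "\<And>v. v \<in> S \<Longrightarrow> m v \<noteq> v"
    "\<And>v. v \<in> V \<Longrightarrow> m v \<noteq> v \<Longrightarrow> v \<in> S \<longleftrightarrow> m v \<notin> S"
  shows "even (cutdeg S (\<lambda>w. (w, m w)) {v} + d {v})"
proof (cases "v \<in> V")
  case True
  have mm: "m w \<in> V" "m (m w) = w" if "w \<in> V" for w using m that by (auto simp: pairing_def)
  have fin: "finite S" using S(1) finV by (rule finite_subset)
  have "cutdeg S (\<lambda>w. (w, m w)) {v} = (\<Sum>w\<in>S. of_bool (w = v) + of_bool (w = m v))"
    unfolding cutdeg_def
  proof (rule sum.cong)
    fix w assume w: "w \<in> S"
    have "m w = v \<longleftrightarrow> w = m v" using mm(2)[of w] mm(2)[of v] w S(1) True by auto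
    moreover have "m w \<noteq> w" using S(2) w by simp
    ultimately show "of_bool ((fst (w, m w) \<in> {v}) \<noteq> (snd (w, m w) \<in> {v})) =
        (of_bool (w = v) + of_bool (w = m v) :: int)" by auto
  qed simp
  also have "\<dots> = of_bool (v \<in> S) + of_bool (m v \<in> S)"
    using fin by (simp add: sum.distrib of_bool_def)
  also have "\<dots> = of_bool (m v \<noteq> v)"
  proof (cases "m v = v")
    case True
    then have "v \<notin> S" using S(2) by blast
    then show ?thesis using True by simp
  next
    case False
    then show ?thesis using S(3)[OF \<open>v \<in> V\<close> False] by simp
  qed
  finally show ?thesis using m True by (auto simp: pairing_def)
next
  case False
  have "d {v} = 0" unfolding cutdeg_def
    by (rule sum.neutral) (use ends_in False in force)
  moreover have "cutdeg S (\<lambda>w. (w, m w)) {v} = 0" unfolding cutdeg_def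
  proof (rule sum.neutral, rule ballI)
    fix w assume "w \<in> S"
    then have "w \<in> V" "m w \<in> V" using S(1) m by (auto simp: pairing_def)
    then show "of_bool ((fst (w, m w) \<in> {v}) \<noteq> (snd (w, m w) \<in> {v})) = (0::int)"
      using False by auto
  qed
  ultimately show ?thesis by simp
qed

text \<open>A pair edge crossing \<open>X\<close> is charged to its end in \<open>X\<close>;
  different pairs are disjoint.\<close>

lemma cutdeg_representatives_le_split:
  assumes m: "pairing m" and S: "S \<subseteq> V" "\<And>v. v \<in> S \<Longrightarrow> m v \<noteq> v"
    "\<And>v. v \<in> V \<Longrightarrow> m v \<noteq> v \<Longrightarrow> v \<in> S \<longleftrightarrow> m v \<notin> S" and X: "X \<subseteq> V"
  shows "cutdeg S (\<lambda>w. (w, m w)) X \<le> split m X"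
proof -
  have mm: "m w \<in> V" "m (m w) = w" if "w \<in> V" for w using m that by (auto simp: pairing_def)
  have fin: "finite S" "finite X" using S(1) X finV finite_subset by blast+
  let ?C = "{w\<in>S. (w \<in> X) \<noteq> (m w \<in> X)}"
  let ?f = "\<lambda>w. if w \<in> X then w else m w"
  have "inj_on ?f ?C"
  proof (rule inj_onI)
    fix v w assume vw: "v \<in> ?C" "w \<in> ?C" "?f v = ?f w"
    then have V: "v \<in> V" "w \<in> V" "v \<in> S" "w \<in> S" using S(1) by auto
    have "v = w \<or> v = m w \<or> w = m v"
      using vw(3) mm(2)[OF V(1)] mm(2)[OF V(2)] by metis
    moreover have "v \<noteq> m w" using S(3)[OF V(2) S(2)[OF V(4)]] V by auto
    moreover have "w \<noteq> m v" using S(3)[OF V(1) S(2)[OF V(3)]] V by auto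
    ultimately show "v = w" by blast
  qed
  moreover have "?f ` ?C \<subseteq> {v\<in>X. m v \<notin> X}" using mm S(1) by auto
  ultimately have "card ?C \<le> card {v\<in>X. m v \<notin> X}"
    using fin by (intro card_inj_on_le[of ?f]) auto
  moreover have "cutdeg S (\<lambda>w. (w, m w)) X = int (card ?C)"
    using fin by (simp add: cutdeg_def of_bool_def sum.If_cases Int_def)
  ultimately show ?thesis by (simp add: split_def)
qed

lemma extend_trail_orientation:
  assumes m: "pairing m" and F: "set es \<subseteq> E" "distinct es" "length vs = Suc (length es)"
    and arcs: "\<And>i. i < length es \<Longrightarrow> arc ends oriH (es ! i) = (vs ! i, vs ! Suc i)"
  obtains ori where "\<And>e. e \<in> set es \<Longrightarrow> ori e = oriH e"
    "\<And>X. X \<subseteq> V \<Longrightarrow> - split m X \<le> excess E (arc ends ori) X"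
proof -
  let ?F = "set es"
  obtain S where S: "S \<subseteq> V" "\<And>v. v \<in> S \<Longrightarrow> m v \<noteq> v"
    "\<And>v. v \<in> V \<Longrightarrow> m v \<noteq> v \<Longrightarrow> v \<in> S \<longleftrightarrow> m v \<notin> S"
    using pairing_representatives[OF m] by blast
  have fin: "finite (E - ?F)" "finite S" "finite (insert None (Some ` S))"
    using S(1) finV finE finite_subset by auto
  \<comment> \<open>The auxiliary graph has the edges off the trail, the edge
    \<open>Inr None\<close> between the ends of the trail (a loop if it is closed), and an edge
    \<open>Inr (Some v)\<close> for each pair.\<close>
  define E' :: "('e + 'v option) set" where "E' = (E - ?F) <+> insert None (Some ` S)"
  define ends' :: "'e + 'v option \<Rightarrow> 'v \<times> 'v" where
    "ends' = case_sum ends (case_option (hd vs, last vs) (\<lambda>v. (v, m v)))"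
  have finE': "finite E'" using fin by (simp add: E'_def)
  have sum': "sum g E' = (\<Sum>e\<in>E - ?F. g (Inl e)) + (g (Inr None) + (\<Sum>v\<in>S. g (Inr (Some v))))"
    for g :: "'e + 'v option \<Rightarrow> int"
  proof -
    have "sum g E' = sum (g \<circ> Inl) (E - ?F) + sum (g \<circ> Inr) (insert None (Some ` S))"
      unfolding E'_def using fin by (intro sum.Plus) auto
    also have "sum (g \<circ> Inr) (insert None (Some ` S)) = g (Inr None) + (\<Sum>v\<in>S. g (Inr (Some v)))"
      using fin by (simp add: sum.reindex image_iff)
    finally show ?thesis by simp
  qed
  have exF: "excess ?F (arc ends oriH) X = of_bool (hd vs \<in> X) - of_bool (last vs \<in> X)" for X
    by (rule excess_trail) fact+
  have spF: "sum g E = sum g (E - ?F) + sum g ?F" for g :: "'e \<Rightarrow> int"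
    using finE F(1) by (intro sum.subset_diff)
  \<comment> \<open>By \<open>exF\<close>, replacing the trail by \<open>Inr None\<close> preserves
    the parity of every degree, and the pair edges then correct the odd ones.\<close>
  have "even (cutdeg E' ends' {v})" for v
  proof -
    have "cutdeg E' ends' {v} = cutdeg (E - ?F) ends {v} +
        (of_bool ((hd vs \<in> {v}) \<noteq> (last vs \<in> {v})) + cutdeg S (\<lambda>w. (w, m w)) {v})"
      unfolding cutdeg_def sum' ends'_def by simp
    moreover have "d {v} = cutdeg (E - ?F) ends {v} + cutdeg ?F ends {v}"
      unfolding cutdeg_def by (rule spF)
    moreover have "even (excess ?F (arc ends oriH) {v} + cutdeg ?F ends {v})"
      by (rule even_excess_cutdeg)
    moreover have "even (cutdeg S (\<lambda>w. (w, m w)) {v} + d {v})"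
      by (rule even_cutdeg_representatives[OF m S])
    moreover have "even (excess ?F (arc ends oriH) {v} + of_bool ((hd vs \<in> {v}) \<noteq> (last vs \<in> {v})))"
      unfolding exF by (cases "hd vs \<in> {v}"; cases "last vs \<in> {v}") simp_all
    ultimately show ?thesis by presburger
  qed
  from balanced_orientation[OF finE' this] obtain \<omega> where
    \<omega>: "\<forall>X. excess E' (arc ends' \<omega>) X = 0" by (elim exE)
  \<comment> \<open>Reversing all edges keeps every excess 0, so \<open>Inr None\<close> may be
    assumed to run along the trail.\<close>
  obtain \<omega>' where \<omega>': "\<forall>X. excess E' (arc ends' \<omega>') X = 0" "\<omega>' (Inr None)"
  proof (cases "\<omega> (Inr None)")
    case True
    then show ?thesis using that \<omega> by blast
  next
    case False
    then show ?thesis using that[of "\<lambda>e. \<not> \<omega> e"] \<omega> by (simp add: excess_reverse)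
  qed
  define ori where "ori e = (if e \<in> ?F then oriH e else \<omega>' (Inl e))" for e
  \<comment> \<open>The oriented trail has the same excess as the arc \<open>Inr None\<close>. Hence
    the excess over \<open>E\<close> is minus that of the pair edges, which is at most
    \<open>split m X\<close>.\<close>
  have "- split m X \<le> excess E (arc ends ori) X" if X: "X \<subseteq> V" for X
  proof -
    have "excess E (arc ends ori) X = excess (E - ?F) (arc ends (\<lambda>e. \<omega>' (Inl e))) X + excess ?F (arc ends oriH) X"
    proof -
      have "excess (E - ?F) (arc ends ori) X = excess (E - ?F) (arc ends (\<lambda>e. \<omega>' (Inl e))) X"
        unfolding excess_def by (rule sum.cong) (simp_all add: arc_def ori_def)
      moreover have "excess ?F (arc ends ori) X = excess ?F (arc ends oriH) X"
        unfolding excess_def by (rule sum.cong) (simp_all add: arc_def ori_def)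
      moreover have "excess E (arc ends ori) X = excess (E - ?F) (arc ends ori) X + excess ?F (arc ends ori) X"
        unfolding excess_def by (rule spF)
      ultimately show ?thesis by simp
    qed
    moreover have "0 = excess (E - ?F) (arc ends (\<lambda>e. \<omega>' (Inl e))) X +
        (of_bool (hd vs \<in> X) - of_bool (last vs \<in> X) +
         excess S (arc (\<lambda>w. (w, m w)) (\<lambda>w. \<omega>' (Inr (Some w)))) X)"
    proof -
      have "0 = excess E' (arc ends' \<omega>') X" using \<omega>'(1) by simp
      also have "\<dots> = (\<Sum>e\<in>E - ?F. of_bool (fst (arc ends' \<omega>' (Inl e)) \<in> X) - of_bool (snd (arc ends' \<omega>' (Inl e)) \<in> X)) +
         (of_bool (fst (arc ends' \<omega>' (Inr None)) \<in> X) - of_bool (snd (arc ends' \<omega>' (Inr None)) \<in> X) +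
          (\<Sum>w\<in>S. of_bool (fst (arc ends' \<omega>' (Inr (Some w))) \<in> X) - of_bool (snd (arc ends' \<omega>' (Inr (Some w))) \<in> X)))"
        unfolding excess_def by (rule sum')
      finally have eq: "0 = (\<Sum>e\<in>E - ?F. of_bool (fst (arc ends' \<omega>' (Inl e)) \<in> X) - of_bool (snd (arc ends' \<omega>' (Inl e)) \<in> X)) +
         (of_bool (fst (arc ends' \<omega>' (Inr None)) \<in> X) - of_bool (snd (arc ends' \<omega>' (Inr None)) \<in> X) +
          (\<Sum>w\<in>S. of_bool (fst (arc ends' \<omega>' (Inr (Some w))) \<in> X) - of_bool (snd (arc ends' \<omega>' (Inr (Some w))) \<in> X)) :: int)" .
      have "arc ends' \<omega>' (Inl e) = arc ends (\<lambda>e. \<omega>' (Inl e)) e" for e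
        by (simp add: arc_def ends'_def)
      moreover have "arc ends' \<omega>' (Inr None) = (hd vs, last vs)"
        using \<omega>'(2) by (simp add: arc_def ends'_def)
      moreover have "arc ends' \<omega>' (Inr (Some w)) =
          arc (\<lambda>w. (w, m w)) (\<lambda>w. \<omega>' (Inr (Some w))) w" for w
        by (simp add: arc_def ends'_def)
      ultimately show ?thesis using eq unfolding excess_def by (simp only: fst_conv snd_conv)
    qed
    moreover have "excess S (arc (\<lambda>w. (w, m w)) (\<lambda>w. \<omega>' (Inr (Some w)))) X \<le> split m X"
      using excess_le_cutdeg cutdeg_representatives_le_split[OF m S X] by (rule order_trans)
    ultimately show ?thesis using exF[of X] by simp
  qed
  moreover have "ori e = oriH e" if "e \<in> ?F" for e using that by (simp add: ori_def)
  ultimately show ?thesis using that by blast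
qed

end

section \<open>From cut bounds to the path counts \<open>lambda\<close> and
  \<open>alpha\<close>\<close>

lemma k_edge_disjoint_0: "k_edge_disjoint P 0"
  by (simp add: k_edge_disjoint_def)

lemma k_edge_disjoint_dipath_path:
  assumes "k_edge_disjoint (is_dipath E ends ori x y) k"
  shows "k_edge_disjoint (is_path E ends x y) k"
proof -
  obtain ps where ps: "length ps = k" "\<forall>p\<in>set ps. is_dipath E ends ori x y (fst p) (snd p)"
    "\<forall>i<k. \<forall>j<k. i \<noteq> j \<longrightarrow> set (fst (ps ! i)) \<inter> set (fst (ps ! j)) = {}"
    using assms unfolding k_edge_disjoint_def by (elim exE conjE)
  have "\<forall>p\<in>set ps. is_path E ends x y (fst p) (snd p)"
    using ps(2) by (auto intro: dipath_path)
  then show ?thesis unfolding k_edge_disjoint_def by (intro exI[of _ ps] conjI ps(1,3))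
qed

text \<open>This makes the \<open>Max\<close> in \<open>lambda\<close> and \<open>alpha\<close>
  meaningful. For \<open>x = y\<close> arbitrarily many copies of the empty path are edge-disjoint;
  otherwise the cut \<open>{x}\<close> bounds their number.\<close>

lemma finite_disjoint_paths:
  assumes "finite E" "x \<noteq> y"
  shows "finite {k. k_edge_disjoint (is_path E ends x y) k}"
proof (rule finite_subset)
  show "{k. k_edge_disjoint (is_path E ends x y) k} \<subseteq> {..nat (cutdeg E ends {x})}"
    using disjoint_paths_le_cut[OF assms(1), of ends x y _ "{x}"] assms(2) by fastforce
qed simp

lemma lambda_le_cut:
  assumes "finite E" "x \<in> X" "y \<notin> X"
  shows "int (lambda E ends x y) \<le> cutdeg E ends X"
proof (rule disjoint_paths_le_cut[OF assms(1) _ assms(2,3)])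
  have "x \<noteq> y" using assms by auto
  then have "finite {k. k_edge_disjoint (is_path E ends x y) k}"
    by (rule finite_disjoint_paths[OF assms(1)])
  moreover have "{k. k_edge_disjoint (is_path E ends x y) k} \<noteq> {}"
    by (metis k_edge_disjoint_0 empty_iff mem_Collect_eq)
  ultimately have "Max {k. k_edge_disjoint (is_path E ends x y) k} \<in> {k. k_edge_disjoint (is_path E ends x y) k}"
    by (rule Max_in)
  then show "k_edge_disjoint (is_path E ends x y) (lambda E ends x y)"
    by (simp add: lambda_def)
qed

lemma alpha_ge:
  assumes "finite E" "x \<noteq> y" "k_edge_disjoint (is_dipath E ends ori x y) k"
  shows "k \<le> alpha E ends ori x y"
  unfolding alpha_def
proof (rule Max_ge)
  show "finite {k. k_edge_disjoint (is_dipath E ends ori x y) k}"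
    using finite_disjoint_paths[OF assms(1,2)]
    by (rule finite_subset[rotated]) (auto intro: k_edge_disjoint_dipath_path)
qed (use assms in simp)

theorem theorem5p1:
  fixes V :: "'v set" and E :: "'e set" and ends :: "'e \<Rightarrow> 'v \<times> 'v"
    and F :: "'e set" and oriH :: "'e \<Rightarrow> bool"
  assumes "multigraph V E ends"
    and "F \<subseteq> E"
    and "\<exists>es vs. eulerian_trail E ends F es vs"
    and "consistent_orientation E ends F oriH"
  shows "\<exists>ori. (\<forall>e\<in>F. arc ends ori e = arc ends oriH e) \<and> well_balanced V E ends ori"
proof -
  interpret mgraph V E ends by standard fact
  obtain es vs where tr: "eulerian_trail E ends F es vs"
    and arcs: "\<forall>i<length es. arc ends oriH (es ! i) = (vs ! i, vs ! Suc i)"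
    using assms(4) unfolding consistent_orientation_def by blast
  have F: "set es = F" "distinct es" "length vs = Suc (length es)"
    using tr by (auto simp: eulerian_trail_def is_trail_def is_walk_def)
  obtain m where "feasible m" using pairing_exists[OF mgraph_axioms] by blast
  then have m: "pairing m" and feas: "\<And>X. X \<subseteq> V \<Longrightarrow> split m X + R X \<le> d X"
    by (auto simp: feasible_def)
  obtain ori where ori: "\<And>e. e \<in> set es \<Longrightarrow> ori e = oriH e"
    "\<And>X. X \<subseteq> V \<Longrightarrow> - split m X \<le> excess E (arc ends ori) X"
    using extend_trail_orientation[OF m, of es vs oriH] F arcs assms(2) by auto
  \<comment> \<open>Twice \<open>outdeg\<close> is \<open>d X\<close> plus the excess, hence at
    least \<open>d X - split m X\<close>, which feasibility bounds below by
    \<open>R X\<close>.\<close>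
  have out: "R X \<le> 2 * outdeg E (arc ends ori) X" if "X \<subseteq> V" for X
    using feas[OF that] ori(2)[OF that] by (simp add: outdeg_excess)
  have "well_balanced V E ends ori" unfolding well_balanced_def
  proof (intro ballI impI)
    fix x y assume xy: "x \<in> V" "y \<in> V" "x \<noteq> y"
    let ?k = "lambda E ends x y div 2"
    obtain Y where Y: "Y \<subseteq> V" "x \<in> Y" "y \<notin> Y" "d Y = lam x y"
      using lam_attained[of x y] xy by metis
    have "int (lambda E ends x y) \<le> lam x y"
      unfolding Y(4)[symmetric] by (rule lambda_le_cut[OF finE Y(2,3)])
    \<comment> \<open>\<open>2 * int ?k\<close> is even and at most \<open>lam x y\<close>, so
      rounding down to \<open>lams\<close> does not lose it.\<close>
    then have k: "2 * int ?k \<le> lams x y" by (intro lams_ge) auto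
    have "k_edge_disjoint (is_dipath E ends ori x y) ?k"
    proof (rule directed_menger[OF finE xy(3)])
      fix X assume X: "x \<in> X" "y \<notin> X"
      \<comment> \<open>Menger's theorem quantifies over all sets, feasibility over subsets of
        \<open>V\<close>; arcs only see \<open>X \<inter> V\<close>.\<close>
      have "outdeg E (arc ends ori) X = outdeg E (arc ends ori) (X \<inter> V)"
        unfolding outdeg_def by (rule sum.cong) (simp_all add: arc_def ends_in)
      moreover have "lams x y \<le> R (X \<inter> V)" using X xy by (intro R_ge) auto
      moreover have "R (X \<inter> V) \<le> 2 * outdeg E (arc ends ori) (X \<inter> V)" by (rule out) simp
      ultimately show "int ?k \<le> outdeg E (arc ends ori) X" using k by simp
    qed
    then have "?k \<le> alpha E ends ori x y" by (rule alpha_ge[OF finE xy(3)])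
    then show "real (lambda_star E ends x y) / 2 \<le> real (alpha E ends ori x y)"
      by (simp add: lambda_star_def)
  qed
  moreover have "\<forall>e\<in>F. arc ends ori e = arc ends oriH e"
    using ori(1) F(1) by (simp add: arc_def)
  ultimately show ?thesis by blast
qed

end
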